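(* Let $1\le q<p\le+\infty$ and $t>0$. Let $\mathcal D$ be a dyadic system on $\mathbb T$. Let $\mu$ and $\omega$ be two weights on $\mathbb D$, and set $\sigma:=\omega^{-1/(p-1)}$. Assume that $\mu,\sigma\in\mathbf B_\infty(\mathcal D)$. Then the following statements are equivalent. (1) $\mathcal M_t^{\mathcal D}$ extends to a bounded operator from $L^p(\omega,\mathbb D)$ to $L^q(\mu,\mathbb D)$. (2) The function $$\phi(z):=\sum_{I\in\mathcal D}\beta_I\,\mathbf 1_{Q_I^{\mathrm{up}}}(z),\qquad \beta_I:=\frac{1}{|Q_I|^{(t-1)q}}\cdot\frac{\mu(Q_I)}{|Q_I|}\cdot\left(\frac{\sigma(Q_I)}{|Q_I|}\right)^{\frac{q}{p'}},$$ belongs to $L^{\frac{p}{p-q}}(\mathbb D)$.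
   Context: $\mathbb D$ is the open unit disc in $\mathbb C$, $dA$ is normalized area measure on $\mathbb D$, $|E|$ denotes the $dA$-measure of $E\subseteq\mathbb D$. $\mathbb T$ is the unit circle with arc length normalized so that $|\mathbb T|=1$; $|I|$ is the normalized length of an arc $I$. A dyadic system on $\mathbb T$ is a collection of arcs $\mathcal D=\bigcup_{k\ge0}\mathcal D_k$ where each $\mathcal D_k$ consists of $2^k$ disjoint arcs of length $2^{-k}$ with union $\mathbb T$, and each arc of $\mathcal D_k$ is the union of two arcs of $\mathcal D_{k+1}$. For an arc $I\subseteq\mathbb T$, the Carleson box is $Q_I:=\{z\in\mathbb D: z/|z|\in I,\ 1-|I|\le|z|<1\}$ and its upper half is $Q_I^{\mathrm{up}}:=\{z\in\mathbb D:z/|z|\in I,\ 1-|I|\le|z|<1-|I|/2\}$ (the single point $z=0$ is a null set and plays no role). For $t>0$, $$\mathcal M_t^{\mathcal D}f(z):=\sup_{I\in\mathcal D,\ z\in Q_I}\frac{1}{|Q_I|^t}\int_{Q_I}|f(w)|\,dA(w).$$ A weight is a nonnegative locally integrable function on $\mathbb D$; for a weight $\eta$ write $\eta(E):=\int_E\eta\,dA$. $L^p(\omega,\mathbb D)$ is the space of measurable $f$ with $\int_{\mathbb D}|f|^p\omega\,dA<\infty$ (usual modification, i.e. essential supremum, when $p=\infty$). A weight $\eta$ belongs to the dyadic class $\mathbf B_\infty(\mathcal D)$ if there is a constant $C>1$ with $\eta(Q_I)\le C\,\eta(Q_I^{\mathrm{up}})$ for every $I\in\mathcal D$. Here $p'$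 is the conjugate exponent, $1/p+1/p'=1$. For $p=\infty$ the usual conventions apply: $1/(p-1)=0$ (so $\sigma\equiv1$), $p'=1$, and $p/(p-q)=1$. *)

theory Defs
  imports "HOL-Probability.Essential_Supremum"
begin

section \<open>Area measure, arcs and dyadic systems\<close>

definition dA :: "complex measure" where
  "dA = scale_measure (ennreal (1 / pi)) (lebesgue_on (ball 0 1))"

text \<open>The arcs of the unit circle are its nonempty connected subsets. No convention on
  endpoints is made, and the whole circle is an arc.\<close>

definition is_arc :: "complex set \<Rightarrow> bool" where
  "is_arc I \<longleftrightarrow> I \<subseteq> sphere 0 1 \<and> I \<noteq> {} \<and> connected I"

definition arc_len :: "complex set \<Rightarrow> real" where
  "arc_len I = measure lebesgue {x \<in> {0..<1}. cis (2 * pi * x) \<in> I}"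

definition dyadic_system :: "complex set set \<Rightarrow> bool" where
  "dyadic_system D \<longleftrightarrow> (\<exists>L :: nat \<Rightarrow> complex set set.
     D = (\<Union>k. L k) \<and>
     (\<forall>k. card (L k) = 2 ^ k \<and> disjoint (L k) \<and> \<Union> (L k) = sphere 0 1) \<and>
     (\<forall>k. \<forall>I\<in>L k. is_arc I \<and> arc_len I = 1 / 2 ^ k) \<and>
     (\<forall>k. \<forall>I\<in>L k. \<exists>J\<in>L (Suc k). \<exists>K\<in>L (Suc k). J \<noteq> K \<and> I = J \<union> K))"

text \<open>The origin lies in no Carleson box, since \<open>0 / 0 = 0\<close> is not on the circle.\<close>

definition carleson_box :: "complex set \<Rightarrow> complex set" where
  "carleson_box I = {z \<in> ball 0 1. z / of_real (cmod z) \<in> I \<and>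
     1 - arc_len I \<le> cmod z \<and> cmod z < 1}"

definition carleson_up :: "complex set \<Rightarrow> complex set" where
  "carleson_up I = {z \<in> ball 0 1. z / of_real (cmod z) \<in> I \<and>
     1 - arc_len I \<le> cmod z \<and> cmod z < 1 - arc_len I / 2}"

section \<open>Weights and Lebesgue spaces\<close>

text \<open>Real powers on \<open>[0, \<infinity>]\<close>, with \<open>x\<^sup>0 = 1\<close> for every \<open>x\<close>, and
  \<open>0\<^sup>a = \<infinity>\<close>, \<open>\<infinity>\<^sup>a = 0\<close> for \<open>a < 0\<close>.\<close>

definition epowr :: "ennreal \<Rightarrow> real \<Rightarrow> ennreal" where
  "epowr x a =
     (if a = 0 then 1
      else if x = \<infinity> then (if a < 0 then 0 else \<infinity>)
      else if x = 0 \<and> a < 0 then \<infinity>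
      else ennreal (enn2real x powr a))"

text \<open>Weights take values in \<open>[0, \<infinity>]\<close>, because a negative power of a nonnegative weight is infinite
  where that weight vanishes. Local integrability forces a weight to be finite almost
  everywhere.\<close>

definition weight :: "(complex \<Rightarrow> ennreal) \<Rightarrow> bool" where
  "weight \<eta> \<longleftrightarrow> \<eta> \<in> borel_measurable dA \<and>
     (\<forall>K. compact K \<and> K \<subseteq> ball 0 1 \<longrightarrow> (\<integral>\<^sup>+z\<in>K. \<eta> z \<partial>dA) < \<infinity>)"

definition mass :: "(complex \<Rightarrow> ennreal) \<Rightarrow> complex set \<Rightarrow> ennreal" where
  "mass \<eta> E = (\<integral>\<^sup>+z\<in>E. \<eta> z \<partial>dA)"

definition B_inf :: "complex set set \<Rightarrow> (complex \<Rightarrow> ennreal) set" where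
  "B_inf D = {\<eta>. weight \<eta> \<and>
     (\<exists>C::real. C > 1 \<and>
        (\<forall>I\<in>D. mass \<eta> (carleson_box I) \<le> ennreal C * mass \<eta> (carleson_up I)))}"

text \<open>For \<open>p = \<infinity>\<close> the essential supremum is taken with respect to area measure, so the weight
  plays no role in that case.\<close>

definition Lp_norm :: "ereal \<Rightarrow> (complex \<Rightarrow> ennreal) \<Rightarrow> (complex \<Rightarrow> ennreal) \<Rightarrow> ennreal" where
  "Lp_norm p \<eta> F =
     (if p = \<infinity> then esssup dA F
      else epowr (\<integral>\<^sup>+z. epowr (F z) (real_of_ereal p) * \<eta> z \<partial>dA) (1 / real_of_ereal p))"

definition Lp :: "ereal \<Rightarrow> (complex \<Rightarrow> ennreal) \<Rightarrow> (complex \<Rightarrow> ennreal) set" where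
  "Lp p \<eta> = {F \<in> borel_measurable dA. Lp_norm p \<eta> F < \<infinity>}"

text \<open>Boundedness of a \<open>[0, \<infinity>]\<close>-valued operator that is defined on all functions.\<close>

definition bounded_Lp_Lq ::
  "ereal \<Rightarrow> (complex \<Rightarrow> ennreal) \<Rightarrow> ereal \<Rightarrow> (complex \<Rightarrow> ennreal)
    \<Rightarrow> ((complex \<Rightarrow> complex) \<Rightarrow> (complex \<Rightarrow> ennreal)) \<Rightarrow> bool" where
  "bounded_Lp_Lq p \<omega> q \<mu> T \<longleftrightarrow> (\<exists>C::real. C \<ge> 0 \<and>
     (\<forall>f\<in>borel_measurable dA. (\<lambda>z. ennreal (cmod (f z))) \<in> Lp p \<omega> \<longrightarrow>
        T f \<in> Lp q \<mu> \<and>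
        Lp_norm q \<mu> (T f) \<le> ennreal C * Lp_norm p \<omega> (\<lambda>z. ennreal (cmod (f z)))))"

section \<open>The maximal operator and the testing function\<close>

definition maximal ::
  "real \<Rightarrow> complex set set \<Rightarrow> (complex \<Rightarrow> complex) \<Rightarrow> complex \<Rightarrow> ennreal" where
  "maximal t D f z = (SUP I\<in>{I\<in>D. z \<in> carleson_box I}.
     (\<integral>\<^sup>+w\<in>carleson_box I. ennreal (cmod (f w)) \<partial>dA)
       / ennreal (measure dA (carleson_box I) powr t))"

definition conj_exp :: "ereal \<Rightarrow> real" where
  "conj_exp p = (if p = \<infinity> then 1 else real_of_ereal p / (real_of_ereal p - 1))"

definition sigma_exp :: "ereal \<Rightarrow> real" where
  "sigma_exp p = (if p = \<infinity> then 0 else - 1 / (real_of_ereal p - 1))"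

definition phi_exp :: "ereal \<Rightarrow> real \<Rightarrow> real" where
  "phi_exp p q = (if p = \<infinity> then 1 else real_of_ereal p / (real_of_ereal p - q))"

definition beta ::
  "ereal \<Rightarrow> real \<Rightarrow> real \<Rightarrow> (complex \<Rightarrow> ennreal) \<Rightarrow> (complex \<Rightarrow> ennreal) \<Rightarrow> complex set \<Rightarrow> ennreal" where
  "beta p q t \<mu> \<sigma> I = (let Q = carleson_box I; a = measure dA Q in
     ennreal (1 / a powr ((t - 1) * q)) * (mass \<mu> Q / ennreal a)
       * epowr (mass \<sigma> Q / ennreal a) (q / conj_exp p))"

definition phi ::
  "ereal \<Rightarrow> real \<Rightarrow> real \<Rightarrow> complex set set \<Rightarrow> (complex \<Rightarrow> ennreal) \<Rightarrow> (complex \<Rightarrow> ennreal)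
    \<Rightarrow> complex \<Rightarrow> ennreal" where
  "phi p q t D \<mu> \<sigma> z = (\<Sum>\<^sub>\<infinity>I\<in>D. beta p q t \<mu> \<sigma> I * indicator (carleson_up I) z)"

end

theory Submission
  imports Defs
begin

text \<open>
  Write \<open>|Q\<^sub>I|\<close> for the area of the box \<open>Q\<^sub>I\<close> over \<open>I\<close>, and \<open>\<mu>\<^sub>I\<close>, \<open>\<sigma>\<^sub>I\<close> for the masses of \<open>Q\<^sub>I\<close>. Both sides of the
  equivalence say that the numbers
  \<open>\<lambda>\<^sub>I = |Q\<^sub>I| powr (- t q) * \<mu>\<^sub>I * \<sigma>\<^sub>I powr (q / p')\<close>
  satisfy \<open>\<Sum>\<^sub>I \<lambda>\<^sub>I powr r < \<infinity>\<close> with \<open>r = p / (p - q)\<close>.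

  For the testing function this is a computation: the upper halves tile the disc, the function is
  the constant \<open>\<beta>\<^sub>I\<close> on the upper half of \<open>Q\<^sub>I\<close>, the area of that half is comparable to \<open>|Q\<^sub>I|\<close>
  (\<open>measure_box_le_up\<close>), and \<open>\<beta>\<^sub>I powr r * |Q\<^sub>I| = \<lambda>\<^sub>I powr r\<close>; see \<open>phi_in_Lp_iff\<close>.

  For the maximal operator, the supremum over the boxes containing a point is at most the sum over
  them, and it is at least the term of the smallest one. As the upper half of a box carries a fixed
  proportion of its \<open>\<mu>\<close>-mass, \<open>\<integral> (M f)\<^sup>q \<mu>\<close> is comparable to
  \<open>\<Sum>\<^sub>I (\<integral>\<^bsub>Q\<^sub>I\<^esub> |f| / |Q\<^sub>I| powr t)\<^sup>q * \<mu>\<^sub>I\<close>, so that boundedness becomes an inequality for this sum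
  (\<open>bounded_iff_box_sum\<close>). With \<open>g\<^sub>I = \<integral>\<^bsub>Q\<^sub>I\<^esub> |f|\<close> its terms are \<open>\<lambda>\<^sub>I * y\<^sub>I\<close> where
  \<open>y\<^sub>I powr (p / q) = \<sigma>\<^sub>I * (g\<^sub>I / \<sigma>\<^sub>I) powr p\<close>, and \<open>r\<close> is conjugate to \<open>p / q\<close>.

  If the \<open>\<lambda>\<^sub>I\<close> are \<open>r\<close>-summable, Young's inequality leaves the sum of the
  \<open>\<sigma>\<^sub>I * (g\<^sub>I / \<sigma>\<^sub>I) powr p\<close> to be bounded by \<open>\<integral> |f|\<^sup>p \<omega>\<close>. Since \<open>\<sigma>\<^sub>I\<close> is at most a multiple of the
  \<open>\<sigma>\<close>-mass of the upper half and the upper halves are disjoint, this is a Carleson embedding. It is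
  proved by a Bellman function induction over the tree of boxes (\<open>tree_carleson_embedding\<close>); the only
  analysis that enters is the tangent line inequality for \<open>x \<mapsto> x\<^sup>p\<close>, which also replaces Hoelder's
  inequality with weights.

  Conversely, testing on \<open>f = \<sigma> * b\<^sub>I\<close> on the upper half of \<open>Q\<^sub>I\<close>, for \<open>I\<close> in the first layers and
  with the \<open>b\<^sub>I\<close> that make the duality between \<open>l\<^sup>r\<close> and its conjugate space sharp, gives
  \<open>S \<le> c * S powr (q / p)\<close> for the partial sums \<open>S\<close> of \<open>\<Sum>\<^sub>I \<lambda>\<^sub>I powr r\<close>, hence \<open>S \<le> c powr r\<close>.

  For \<open>p = \<infinity>\<close> the constant function \<open>1\<close> is extremal and the sum for it is \<open>\<Sum>\<^sub>I \<lambda>\<^sub>I\<close>.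
\<close>

section \<open>Arcs and Carleson boxes\<close>

text \<open>An arc that misses a point \<open>a\<close> of the circle lies in the circle cut at \<open>a\<close>, which the argument
  of \<open>- z / a\<close> maps injectively and continuously into the line. There the image of the arc is an
  interval.\<close>

lemma arc_borel:
  assumes "is_arc I"
  shows "I \<in> sets borel"
proof (cases "I = sphere 0 1")
  case True
  then show ?thesis by auto
next
  case False
  with assms obtain a where a: "cmod a = 1" "a \<notin> I"
    by (force simp: is_arc_def)
  have sub: "I \<subseteq> sphere 0 1 - {a}"
    using assms a by (auto simp: is_arc_def)
  define U where "U = sphere 0 1 - {a}"
  have subU: "I \<subseteq> U" using sub by (simp add: U_def)
  have U: "U \<in> sets borel" unfolding U_def by auto
  define g where "g = (\<lambda>z. Arg (- (z / a)))"
  have a0: "a \<noteq> 0" using a by auto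
  have slit: "- (z / a) \<notin> \<real>\<^sub>\<le>\<^sub>0" if "z \<in> U" for z
  proof
    assume h: "- (z / a) \<in> \<real>\<^sub>\<le>\<^sub>0"
    have n: "cmod (- (z / a)) = 1"
      using that a by (auto simp: U_def norm_divide)
    from h obtain r where r: "- (z / a) = of_real r" "r \<le> 0"
      by (auto simp: nonpos_Reals_def)
    with n have "r = -1" by auto
    with r have "z / a = 1" by (metis add.inverse_inverse of_real_1 of_real_minus)
    then show False using that a0 by (auto simp: U_def)
  qed
  have cont: "continuous_on U g"
    unfolding g_def by (intro continuous_intros slit a0 ballI)
  have inj: "inj_on g U"
  proof (rule inj_onI)
    fix x y assume xy: "x \<in> U" "y \<in> U" "g x = g y"
    have nz: "- (x / a) \<noteq> 0" "- (y / a) \<noteq> 0"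
      using xy a0 by (auto simp: U_def)
    have "cmod (- (x / a)) = 1" "cmod (- (y / a)) = 1"
      using xy a by (auto simp: U_def norm_divide)
    with nz xy(3) have "- (x / a) = - (y / a)"
      using Arg_eq[of "- (x/a)"] Arg_eq[of "- (y/a)"] by (simp add: g_def)
    then show "x = y" using a0 by auto
  qed
  have "connected (g ` I)"
    using assms sub cont by (intro connected_continuous_image) (auto simp: is_arc_def U_def intro: continuous_on_subset)
  then have J: "g ` I \<in> sets borel"
    by (intro real_interval_borel_measurable) (simp add: is_interval_connected_1)
  have m: "(\<lambda>z. indicator U z *\<^sub>R g z) \<in> borel_measurable borel"
    using U cont by (rule borel_measurable_continuous_on_indicator)
  have "I = U \<inter> ((\<lambda>z. indicator U z *\<^sub>R g z) -` (g ` I) \<inter> space borel)"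
  proof (intro equalityI subsetI)
    fix x assume "x \<in> U \<inter> ((\<lambda>z. indicator U z *\<^sub>R g z) -` (g ` I) \<inter> space borel)"
    then have "x \<in> U" "g x \<in> g ` I" by auto
    then obtain y where "y \<in> I" "g x = g y" by blast
    with inj \<open>x \<in> U\<close> subU show "x \<in> I" by (metis inj_onD subsetD)
  qed (use subU in auto)
  also have "\<dots> \<in> sets borel"
    using U measurable_sets[OF m J] by (rule sets.Int)
  finally show ?thesis .
qed

text \<open>The boxes and their upper halves are differences of such sectors, whose areas scale with the
  square of the radius. This gives the ratio of the areas without polar coordinates.\<close>

definition sector :: "complex set \<Rightarrow> real \<Rightarrow> complex set" where
  "sector I r = {z. z / of_real (cmod z) \<in> I \<and> cmod z < r}"

lemma sector_borel: "is_arc I \<Longrightarrow> sector I r \<in> sets borel"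
proof -
  assume "is_arc I"
  note [measurable] = arc_borel[OF this]
  show ?thesis unfolding sector_def by measurable
qed

lemma sector_lmeasurable: "is_arc I \<Longrightarrow> sector I r \<in> lmeasurable"
proof (rule bounded_set_imp_lmeasurable)
  show "bounded (sector I r)"
    by (rule bounded_subset[of "ball 0 r"]) (auto simp: sector_def)
qed (simp add: sector_borel)

lemma measure_sector:
  assumes "0 \<le> r"
  shows "measure lebesgue (sector I r) = r\<^sup>2 * measure lebesgue (sector I 1)"
proof (cases "r = 0")
  case True
  then have "sector I r = {}" by (auto simp: sector_def)
  then show ?thesis using True by simp
next
  case False
  with assms have r: "r > 0" by simp
  have "sector I r = (\<lambda>x. r *\<^sub>R x + 0) ` sector I 1"
  proof (intro equalityI subsetI)
    fix z assume z: "z \<in> sector I r"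
    have "z = r *\<^sub>R (z /\<^sub>R r) + 0" using r by simp
    moreover have "z /\<^sub>R r \<in> sector I 1"
      using z r by (auto simp: sector_def scaleR_conv_of_real norm_divide norm_mult field_simps)
    ultimately show "z \<in> (\<lambda>x. r *\<^sub>R x + 0) ` sector I 1" by blast
  next
    fix z assume "z \<in> (\<lambda>x. r *\<^sub>R x + 0) ` sector I 1"
    then show "z \<in> sector I r"
      using r by (auto simp: sector_def scaleR_conv_of_real field_simps norm_mult)
  qed
  then show ?thesis
    using measure_lebesgue_affine[of r 0 "sector I 1"] r by simp
qed

lemma space_dA: "space dA = ball 0 1"
  by (simp add: dA_def space_scale_measure)

lemma sets_dA: "sets dA = sets (lebesgue_on (ball 0 1))"
  by (simp add: dA_def)

lemma finite_measure_dA: "finite_measure dA"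
proof (rule finite_measureI)
  have "emeasure (lebesgue_on (ball 0 1)) (ball 0 1 :: complex set) < \<infinity>"
    using finite_measure.emeasure_finite[OF finite_measure_lebesgue_on[of "ball 0 1 :: complex set"], of "ball 0 1"]
    by (auto simp: less_top)
  then show "emeasure dA (space dA) \<noteq> \<infinity>"
    by (simp add: dA_def space_scale_measure ennreal_mult_eq_top_iff)
qed

lemma borel_in_sets_dA: "A \<in> sets borel \<Longrightarrow> A \<subseteq> ball 0 1 \<Longrightarrow> A \<in> sets dA"
  by (simp add: sets_dA sets_restrict_space_iff)

lemma measure_dA:
  "A \<in> sets borel \<Longrightarrow> A \<subseteq> ball 0 1 \<Longrightarrow> measure dA A = measure lebesgue A / pi"
  by (simp add: dA_def measure_restrict_space)

lemma box_eq_sector_diff: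
  assumes "arc_len I > 0"
  shows "carleson_box I = sector I 1 - sector I (1 - arc_len I)"
    and "carleson_up I = sector I (1 - arc_len I / 2) - sector I (1 - arc_len I)"
  using assms by (auto simp: carleson_box_def carleson_up_def sector_def)

lemma carleson_up_subset: "arc_len I > 0 \<Longrightarrow> carleson_up I \<subseteq> carleson_box I"
  by (auto simp: carleson_box_def carleson_up_def)

lemma box_borel:
  assumes "is_arc I" "arc_len I > 0"
  shows "carleson_box I \<in> sets borel" "carleson_up I \<in> sets borel"
  using assms by (auto simp: box_eq_sector_diff sector_borel)

lemma box_sets_dA:
  assumes "is_arc I" "arc_len I > 0"
  shows "carleson_box I \<in> sets dA" "carleson_up I \<in> sets dA"
  using box_borel[OF assms]
  by (auto intro!: borel_in_sets_dA simp: carleson_box_def carleson_up_def)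

text \<open>With \<open>h\<close> the length of the arc and \<open>s\<close> the area of the full sector, the two areas are
  \<open>(1 - (1 - h)\<^sup>2) s / \<pi>\<close> and \<open>((1 - h/2)\<^sup>2 - (1 - h)\<^sup>2) s / \<pi>\<close>. Four times the second minus the first
  is \<open>2 h (1 - h) s / \<pi>\<close>.\<close>

lemma measure_box_le_up:
  assumes I: "is_arc I" and h: "0 < arc_len I" "arc_len I \<le> 1"
  shows "measure dA (carleson_box I) \<le> 4 * measure dA (carleson_up I)"
proof -
  define h where "h = arc_len I"
  define s where "s = measure lebesgue (sector I 1)"
  have s: "s \<ge> 0" by (simp add: s_def)
  have diff: "measure lebesgue (sector I b - sector I a) = (b\<^sup>2 - a\<^sup>2) * s"
    if "0 \<le> a" "a \<le> b" for a b
  proof -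
    have sub: "sector I a \<subseteq> sector I b" using that by (auto simp: sector_def)
    have "measure lebesgue (sector I b - sector I a)
        = measure lebesgue (sector I b) - measure lebesgue (sector I a)"
      using sector_lmeasurable[OF I] sub by (simp add: measurable_measure_Diff fmeasurableD)
    then show ?thesis
      using that measure_sector[of a I] measure_sector[of b I] by (simp add: s_def algebra_simps)
  qed
  have 1: "measure dA (carleson_box I) = (1\<^sup>2 - (1 - h)\<^sup>2) * s / pi"
    using box_borel[OF I h(1)] h diff[of "1 - h" 1] box_eq_sector_diff(1)[OF h(1)]
    by (subst measure_dA) (auto simp: h_def carleson_box_def)
  have 2: "measure dA (carleson_up I) = ((1 - h / 2)\<^sup>2 - (1 - h)\<^sup>2) * s / pi"
    using box_borel[OF I h(1)] h diff[of "1 - h" "1 - h / 2"] box_eq_sector_diff(2)[OF h(1)]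
    by (subst measure_dA) (auto simp: h_def carleson_up_def)
  have "4 * ((1 - h / 2)\<^sup>2 - (1 - h)\<^sup>2) - (1\<^sup>2 - (1 - h)\<^sup>2) = 2 * h * (1 - h)"
    by (simp add: power2_eq_square field_simps)
  moreover have "\<dots> \<ge> 0" using h by (simp add: h_def)
  ultimately have "(1\<^sup>2 - (1 - h)\<^sup>2) * s \<le> 4 * ((1 - h / 2)\<^sup>2 - (1 - h)\<^sup>2) * s"
    using s by (intro mult_right_mono) auto
  then have "(1\<^sup>2 - (1 - h)\<^sup>2) * s / pi \<le> 4 * ((1 - h / 2)\<^sup>2 - (1 - h)\<^sup>2) * s / pi"
    by (intro divide_right_mono) auto
  then show ?thesis unfolding 1 2 by (simp only: times_divide_eq_right mult.assoc)
qed

lemma mass_mono: "A \<subseteq> B \<Longrightarrow> mass h A \<le> mass h B"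
  unfolding mass_def by (intro nn_integral_mono) (auto simp: indicator_def)

lemma mass_null: "A \<in> sets dA \<Longrightarrow> measure dA A = 0 \<Longrightarrow> mass h A = 0"
proof -
  assume A: "A \<in> sets dA" "measure dA A = 0"
  interpret finite_measure dA by (rule finite_measure_dA)
  have "A \<in> null_sets dA" using A by (auto simp: emeasure_eq_measure intro: null_setsI)
  then show ?thesis unfolding mass_def by (intro nn_integral_null_set) auto
qed

section \<open>Powers and convexity inequalities\<close>

lemma epowr_ennreal: "a > 0 \<Longrightarrow> x \<ge> 0 \<Longrightarrow> epowr (ennreal x) a = ennreal (x powr a)"
  by (simp add: epowr_def)

lemma epowr_top: "a > 0 \<Longrightarrow> epowr top a = top"
  by (simp add: epowr_def)

lemma epowr_mono:
  assumes "a > 0" "x \<le> y"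
  shows "epowr x a \<le> epowr y a"
proof (cases y)
  case (real v)
  then obtain u where u: "x = ennreal u" "u \<ge> 0"
    using assms by (cases x) (auto simp: top_unique)
  then show ?thesis
    using real assms by (simp add: epowr_ennreal ennreal_leI powr_mono2)
qed (use assms in \<open>simp add: epowr_top\<close>)

lemma epowr_inverse: "a > 0 \<Longrightarrow> epowr (epowr x a) (1 / a) = x"
  by (cases x) (auto simp: epowr_ennreal epowr_top powr_powr)

lemma epowr_inverse': "a > 0 \<Longrightarrow> epowr (epowr x (1 / a)) a = x"
  using epowr_inverse[of "1 / a" x] by simp

lemma epowr_less_top: "a > 0 \<Longrightarrow> epowr x a < top \<longleftrightarrow> x < top"
  by (cases x) (auto simp: epowr_ennreal epowr_top)

lemma epowr_measurable [measurable]: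
  assumes [measurable]: "f \<in> borel_measurable M"
  shows "(\<lambda>x. epowr (f x) a) \<in> borel_measurable M"
  unfolding epowr_def by measurable

lemma epowr_epowr: "a > 0 \<Longrightarrow> b > 0 \<Longrightarrow> epowr (epowr x a) b = epowr x (a * b)"
  by (cases x) (auto simp: epowr_ennreal epowr_top powr_powr)

text \<open>The graph of \<open>x \<mapsto> x\<^sup>p\<close> lies above its tangent at \<open>c\<close>. Being linear in \<open>x\<close>, the bound can be
  integrated and summed over boxes for a fixed \<open>c\<close>; optimizing over \<open>c\<close> afterwards recovers
  Jensen's inequality.\<close>

lemma powr_tangent:
  fixes p x c :: real
  assumes p: "p > 1" and "x \<ge> 0" "c \<ge> 0"
  shows "p * c powr (p - 1) * x \<le> x powr p + (p - 1) * c powr p"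
proof -
  have "x * c powr (p - 1) \<le> x powr p / p + (c powr (p - 1)) powr (p / (p - 1)) / (p / (p - 1))"
    using assms by (intro Youngs_inequality) (auto simp: field_simps)
  also have "(c powr (p - 1)) powr (p / (p - 1)) = c powr p"
    using p by (simp add: powr_powr)
  finally have "p * (x * c powr (p - 1)) \<le> p * (x powr p / p + c powr p / (p / (p - 1)))"
    using p by (intro mult_left_mono) auto
  also have "\<dots> = x powr p + (p - 1) * c powr p"
    using p by (simp add: field_simps)
  finally show ?thesis by (simp add: mult_ac)
qed

text \<open>This handles the boxes without \<open>\<sigma>\<close>-mass, for which the tangent inequality loses its last term.\<close>

lemma zero_of_powr_bound:
  fixes p G F :: real
  assumes p: "p > 1" and "G \<ge> 0" and bound: "\<And>c. c \<ge> 0 \<Longrightarrow> p * c powr (p - 1) * G \<le> F"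
  shows "G = 0"
proof (rule ccontr)
  assume "G \<noteq> 0"
  with \<open>G \<ge> 0\<close> have G: "G > 0" by simp
  have F: "F \<ge> 0" using bound[of 0] p by simp
  define b where "b = (F + 1) / (p * G)"
  have b: "b > 0" using F G p by (simp add: b_def)
  have "p * (b powr (1 / (p - 1))) powr (p - 1) * G \<le> F"
    by (rule bound) simp
  then have "p * b * G \<le> F" using p b by (simp add: powr_powr)
  then show False using G p by (simp add: b_def)
qed

text \<open>Young's inequality for \<open>x\<close> and \<open>y / w powr (1 / u)\<close>. Summed over a family with \<open>w\<close>
  at least the sum of the \<open>y\<^sup>u\<close>, it bounds the sum of the \<open>x y\<close> by a multiple of \<open>w powr (1 / u)\<close>, which is
  the dependence on \<open>y\<close> that Hoelder's inequality gives.\<close>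

lemma young_scaled:
  fixes x y w u :: real
  assumes u: "u > 1" and "x \<ge> 0" "y \<ge> 0" "w > 0"
  shows "x * y \<le> w powr (1 / u) * (x powr (u / (u - 1)) + y powr u / w)"
proof -
  define v where "v = w powr (1 / u)"
  have v: "v > 0" "v powr u = w" using assms by (auto simp: v_def powr_powr)
  have "x * (y / v) \<le> x powr (u / (u - 1)) / (u / (u - 1)) + (y / v) powr u / u"
    using assms v by (intro Youngs_inequality) (auto simp: field_simps)
  also have "\<dots> \<le> x powr (u / (u - 1)) / 1 + (y / v) powr u / 1"
    using u by (intro add_mono divide_left_mono) (auto simp: field_simps)
  also have "(y / v) powr u = y powr u / w"
    using assms v by (simp add: powr_divide)
  finally have "v * (x * (y / v)) \<le> v * (x powr (u / (u - 1)) + y powr u / w)"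
    using v by (intro mult_left_mono) auto
  moreover have "v * (x * (y / v)) = x * y" using v by simp
  ultimately show ?thesis by (simp add: v_def)
qed

text \<open>With \<open>\<sigma> = w powr (- 1 / (P - 1))\<close> this is the tangent inequality for \<open>x / \<sigma>\<close>, multiplied by \<open>\<sigma>\<close>,
  because \<open>\<sigma>\<^sup>P = \<sigma> / w\<close>. Where \<open>w\<close> is \<open>0\<close> or infinite, one of the terms on the right is infinite
  unless the left side vanishes.\<close>

lemma weight_tangent:
  fixes P c x :: real
  assumes P: "P > 1" and c: "c \<ge> 0" and x: "x \<ge> 0"
  shows "ennreal (P * c powr (P - 1)) * ennreal x
    \<le> epowr (ennreal x) P * w + ennreal ((P - 1) * c powr P) * epowr w (- 1 / (P - 1))"
proof (cases "w = \<infinity> \<or> w = 0 \<or> c = 0")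
  case True
  then consider "c = 0" | "x = 0" | "w = \<infinity>" "x > 0" | "w = 0" "c > 0"
    using c x by fastforce
  then show ?thesis
  proof cases
    case 3
    then show ?thesis using P by (simp add: epowr_ennreal ennreal_mult_top)
  next
    case 4
    have "epowr w (- 1 / (P - 1)) = top"
      using 4 P by (simp add: epowr_def)
    then show ?thesis using 4 P by (simp add: ennreal_mult_top)
  qed (use P in auto)
next
  case False
  then obtain v where v: "w = ennreal v" "v > 0"
    by (cases w) auto
  define s where "s = v powr (- 1 / (P - 1))"
  have s: "s > 0" using v by (simp add: s_def)
  have ps: "s powr (P - 1) = 1 / v"
  proof -
    have "s powr (P - 1) = v powr (- 1 / (P - 1) * (P - 1))" unfolding s_def by (rule powr_powr)
    also have "- 1 / (P - 1) * (P - 1) = - 1" using P by simp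
    finally show ?thesis using v by (simp add: powr_minus_divide)
  qed
  have "s powr P = s powr (P - 1) * s"
    using s by (simp add: powr_diff)
  then have Ps: "s powr P = s / v" using ps by simp
  have "s * (P * c powr (P - 1) * (x / s)) \<le> s * ((x / s) powr P + (P - 1) * c powr P)"
    using powr_tangent[OF P, of "x / s" c] s x c by (intro mult_left_mono) auto
  also have "s * ((x / s) powr P + (P - 1) * c powr P) = x powr P * v + (P - 1) * c powr P * s"
    using s x v by (simp add: powr_divide Ps field_simps)
  finally have *: "P * c powr (P - 1) * x \<le> x powr P * v + (P - 1) * c powr P * s"
    using s by simp
  have "epowr w (- 1 / (P - 1)) = ennreal s"
    using v P by (simp add: epowr_def s_def)
  then show ?thesis
    using * P v s x by (simp add: epowr_ennreal ennreal_leI flip: ennreal_mult ennreal_plus)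
qed

section \<open>A Carleson embedding on a finite tree\<close>

text \<open>The sum of \<open>a\<close> over the descendants of \<open>I\<close> in fewer than \<open>n\<close> generations.\<close>

primrec tree_sum :: "('i \<Rightarrow> 'i set) \<Rightarrow> ('i \<Rightarrow> real) \<Rightarrow> nat \<Rightarrow> 'i \<Rightarrow> real" where
  "tree_sum ch a 0 I = 0"
| "tree_sum ch a (Suc n) I = a I + (\<Sum>J\<in>ch I. tree_sum ch a n J)"

text \<open>A node \<open>I\<close> has mass \<open>s\<close>, of which it keeps \<open>s0\<close> and passes the rest on to its children; in the same
  way it shares out \<open>G\<close> and \<open>F\<close>, the integrals of a function and of its \<open>p\<close>-th power. With \<open>N\<close>
  the total of \<open>s0\<close> over the first \<open>n\<close> generations, counted from \<open>I\<close> itself, and \<open>C = 2\<^sup>p / (p - 1)\<close>, the induction proves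
  \<open>A \<le> C * (F - G\<^sup>p / (s + N) powr (p - 1))\<close> for the sum \<open>A\<close> in question. The right side is the
  classical Bellman function of the Carleson embedding theorem. Its subtracted term is carried as the supremum over
  \<open>c\<close> of its tangents \<open>p c powr (p - 1) G - (p - 1) c\<^sup>p (s + N)\<close>, which are linear in the data and
  therefore add up over the children. In \<open>s + N\<close> the mass \<open>s0\<close> of the node counts twice, once in \<open>s\<close>
  and once in \<open>N\<close>, whereas the tangent inequality for the part that the node keeps uses it only once.
  The difference \<open>C (p - 1) c\<^sup>p s0\<close> pays for the new term \<open>s0 * (G / s)\<^sup>p\<close>, because \<open>s + N \<le> 2 s\<close>.\<close>

lemma tree_carleson_embedding:
  fixes s s0 G G0 F F0 :: "'i \<Rightarrow> real" and p :: real
  assumes p: "p > 1"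
    and ch: "\<And>I. I \<in> S \<Longrightarrow> ch I \<subseteq> S"
    and s0: "\<And>I. I \<in> S \<Longrightarrow> 0 \<le> s0 I" and s: "\<And>I. I \<in> S \<Longrightarrow> 0 \<le> s I"
    and G: "\<And>I. I \<in> S \<Longrightarrow> 0 \<le> G I" and F: "\<And>I. I \<in> S \<Longrightarrow> 0 \<le> F I"
    and s_split: "\<And>I. I \<in> S \<Longrightarrow> s I = s0 I + (\<Sum>J\<in>ch I. s J)"
    and G_split: "\<And>I. I \<in> S \<Longrightarrow> G I = G0 I + (\<Sum>J\<in>ch I. G J)"
    and F_split: "\<And>I. I \<in> S \<Longrightarrow> F I = F0 I + (\<Sum>J\<in>ch I. F J)"
    and jensen0: "\<And>I c. I \<in> S \<Longrightarrow> 0 \<le> c \<Longrightarrow>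
          p * c powr (p - 1) * G0 I \<le> F0 I + (p - 1) * c powr p * s0 I"
    and jensen: "\<And>I c. I \<in> S \<Longrightarrow> 0 \<le> c \<Longrightarrow>
          p * c powr (p - 1) * G I \<le> F I + (p - 1) * c powr p * s I"
    and I: "I \<in> S"
  shows "tree_sum ch (\<lambda>I. s0 I * (G I / s I) powr p) n I \<le> 2 powr p / (p - 1) * F I"
proof -
  define C where "C = 2 powr p / (p - 1)"
  have C: "C > 0" using p by (simp add: C_def)
  define A where "A = tree_sum ch (\<lambda>I. s0 I * (G I / s I) powr p)"
  define N where "N = tree_sum ch s0"
  have N: "0 \<le> N n I \<and> N n I \<le> s I" if "I \<in> S" for n I
    using that
  proof (induction n arbitrary: I)
    case 0 then show ?case using s by (simp add: N_def)
  next
    case (Suc n)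
    have "0 \<le> (\<Sum>J\<in>ch I. N n J) \<and> (\<Sum>J\<in>ch I. N n J) \<le> (\<Sum>J\<in>ch I. s J)"
      using Suc ch by (auto intro!: sum_nonneg sum_mono)
    then show ?case using s0[OF Suc.prems] s_split[OF Suc.prems] by (simp add: N_def)
  qed
  have G_zero: "G I = 0" if "I \<in> S" "s I = 0" for I
    using jensen[OF that(1)] that by (intro zero_of_powr_bound[OF p G[OF that(1)]]) auto
  have key: "A n I + C * (p * c powr (p - 1) * G I) \<le> C * (F I + (p - 1) * c powr p * (s I + N n I))"
    if "I \<in> S" "c \<ge> 0" for n I c
    using that
  proof (induction n arbitrary: I c)
    case 0
    then show ?case using jensen[of I c] C by (simp add: A_def N_def)
  next
    case (Suc n)
    note IS = \<open>I \<in> S\<close>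
    define v where "v = s I + N (Suc n) I"
    \<comment> \<open>The tangent point at which the supremum over \<open>c\<close> is attained for this node.\<close>
    define d where "d = G I / v"
    define dp where "dp = d powr p"
    define dq where "dq = d powr (p - 1)"
    have v: "s I \<le> v" "v \<le> 2 * s I" "0 \<le> v"
      using N[OF IS, of "Suc n"] s[OF IS] by (auto simp: v_def)
    have d: "d \<ge> 0" using G[OF IS] v by (simp add: d_def)
    have dv: "d * v = G I"
      using G_zero[OF IS] v by (cases "v = 0") (auto simp: d_def)
    have dpq: "dp = dq * d"
    proof (cases "d = 0")
      case False
      then show ?thesis using d unfolding dp_def dq_def
        by (metis diff_add_cancel less_eq_real_def powr_add powr_one)
    qed (simp add: dp_def)
    have dpv: "dp * v = dq * G I" using dpq dv by (simp add: mult.assoc)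
    have "(\<Sum>J\<in>ch I. A n J + C * (p * dq * G J))
        \<le> (\<Sum>J\<in>ch I. C * (F J + (p - 1) * dp * (s J + N n J)))"
      using Suc.IH[OF _ d] ch[OF IS] unfolding dp_def dq_def by (intro sum_mono) auto
    then have 1: "(\<Sum>J\<in>ch I. A n J) + C * (p * dq * (\<Sum>J\<in>ch I. G J))
        \<le> C * ((\<Sum>J\<in>ch I. F J) + (p - 1) * dp * ((\<Sum>J\<in>ch I. s J) + (\<Sum>J\<in>ch I. N n J)))"
      by (simp add: sum.distrib sum_distrib_left distrib_left)
    have Nv: "(\<Sum>J\<in>ch I. s J) + (\<Sum>J\<in>ch I. N n J) = v - 2 * s0 I"
      using s_split[OF IS] by (simp add: v_def N_def)
    have 2: "C * (p * dq * G0 I) \<le> C * (F0 I + (p - 1) * dp * s0 I)"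
      using jensen0[OF IS d] C by (simp add: dp_def dq_def)
    have "G I / s I \<le> 2 * d"
    proof (cases "s I = 0")
      case False
      then have "s I > 0" "v > 0" using s[OF IS] v by auto
      then show ?thesis using mult_left_mono[OF v(2) G[OF IS]] by (simp add: d_def field_simps)
    qed (use d in simp)
    then have "(G I / s I) powr p \<le> (2 * d) powr p"
      using G[OF IS] s[OF IS] p by (intro powr_mono2) auto
    also have "\<dots> = C * ((p - 1) * dp)"
      using p d by (simp add: C_def dp_def powr_mult)
    finally have 3: "s0 I * (G I / s I) powr p \<le> s0 I * (C * ((p - 1) * dp))"
      using s0[OF IS] by (rule mult_left_mono)
    have A_Suc: "A (Suc n) I = s0 I * (G I / s I) powr p + (\<Sum>J\<in>ch I. A n J)"
      by (simp add: A_def)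
    have "A (Suc n) I + C * (p * dq * G I) \<le> C * (F I + (p - 1) * (dp * v))"
      using 1 2 3 unfolding A_Suc Nv F_split[OF IS] G_split[OF IS]
      by (simp add: algebra_simps)
    then have 4: "A (Suc n) I + C * (dq * G I) \<le> C * F I"
      unfolding dpv by (simp add: algebra_simps)
    \<comment> \<open>The bound at the optimal point \<open>d\<close> implies the one for every other \<open>c\<close>.\<close>
    have "(p * c powr (p - 1) * d) * v \<le> (dp + (p - 1) * c powr p) * v"
      using powr_tangent[OF p d \<open>c \<ge> 0\<close>] v unfolding dp_def by (intro mult_right_mono) auto
    then have "p * c powr (p - 1) * G I \<le> dq * G I + (p - 1) * c powr p * v"
      using dpv dv by (simp add: distrib_right mult.assoc)
    then have "C * (p * c powr (p - 1) * G I) \<le> C * (dq * G I + (p - 1) * c powr p * v)"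
      using C by simp
    with 4 show ?case unfolding v_def[symmetric] by (simp add: distrib_left)
  qed
  show ?thesis
    using key[OF I, of 0 n] p by (simp add: A_def C_def)
qed

section \<open>The tree of Carleson boxes and the tiling of the disc\<close>

text \<open>The layers of a dyadic system, fixed once and for all; the system itself is their union \<open>D\<close>.\<close>

locale dyadic_layers =
  fixes L :: "nat \<Rightarrow> complex set set"
  assumes card_layer: "card (L k) = 2 ^ k"
    and disjoint_layer: "disjoint (L k)"
    and union_layer: "\<Union> (L k) = sphere 0 1"
    and layer_arc: "I \<in> L k \<Longrightarrow> is_arc I"
    and layer_len: "I \<in> L k \<Longrightarrow> arc_len I = 1 / 2 ^ k"
    and layer_halves: "I \<in> L k \<Longrightarrow> \<exists>J\<in>L (Suc k). \<exists>K\<in>L (Suc k). J \<noteq> K \<and> I = J \<union> K"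
begin

definition D :: "complex set set" where "D = (\<Union>k. L k)"

text \<open>The length determines the layer, so the layer index need not be carried along.\<close>

definition children :: "complex set \<Rightarrow> complex set set" where
  "children I = {J \<in> D. J \<subseteq> I \<and> arc_len J = arc_len I / 2}"

lemma finite_layer: "finite (L k)"
  by (rule card_ge_0_finite) (simp add: card_layer)

lemma layer_in_D: "I \<in> L k \<Longrightarrow> I \<in> D"
  by (auto simp: D_def)

lemma countable_D: "countable D"
  by (simp add: D_def finite_layer countable_finite)

lemma layer_unique: "I \<in> L k \<Longrightarrow> I \<in> L j \<Longrightarrow> k = j"
  using layer_len[of I k] layer_len[of I j] by simp

lemma layer_eq: "I \<in> L k \<Longrightarrow> J \<in> L k \<Longrightarrow> x \<in> I \<Longrightarrow> x \<in> J \<Longrightarrow> I = J"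
  using disjoint_layer[of k] by (auto simp: disjoint_def)

lemma D_arc: "I \<in> D \<Longrightarrow> is_arc I"
  and D_len: "I \<in> D \<Longrightarrow> 0 < arc_len I" "I \<in> D \<Longrightarrow> arc_len I \<le> 1"
  by (auto simp: D_def layer_len intro: layer_arc)

lemma children_in_D: "children I \<subseteq> D"
  by (auto simp: children_def)

lemma children_layer: "I \<in> L k \<Longrightarrow> children I = {J \<in> L (Suc k). J \<subseteq> I}"
proof -
  assume I: "I \<in> L k"
  have "J \<in> L (Suc k)" if "J \<in> L j" "arc_len J = arc_len I / 2" for J j
  proof -
    have "(1::real) / 2 ^ j = 1 / 2 ^ Suc k"
      using that layer_len[OF I] layer_len[OF that(1)] by simp
    then have "(2::real) ^ j = 2 ^ Suc k" by simp
    then have "j = Suc k" by (subst (asm) power_inject_exp) auto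
    then show ?thesis using that by simp
  qed
  then show ?thesis using I by (auto simp: children_def D_def layer_len)
qed

lemma finite_children: "I \<in> D \<Longrightarrow> finite (children I)"
  by (auto simp: D_def children_layer finite_layer)

lemma parent_exists:
  assumes "J \<in> L (Suc k)"
  shows "\<exists>I\<in>L k. J \<subseteq> I"
proof -
  obtain x where x: "x \<in> J" "x \<in> sphere 0 1"
    using layer_arc[OF assms] unfolding is_arc_def by blast
  then obtain I where I: "I \<in> L k" "x \<in> I" using union_layer[of k] by blast
  obtain A B where "A \<in> L (Suc k)" "B \<in> L (Suc k)" "I = A \<union> B"
    using layer_halves[OF I(1)] by blast
  then have "J = A \<or> J = B" using I x layer_eq[OF assms] by auto
  then show ?thesis using I \<open>I = A \<union> B\<close> by blast
qed

lemma sum_children: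
  "(\<Sum>I\<in>L k. \<Sum>J\<in>children I. g J) = (\<Sum>J\<in>L (Suc k). g J)"
proof -
  have "L (Suc k) = (\<Union>I\<in>L k. children I)"
    using parent_exists by (force simp: children_layer)
  moreover have "children I \<inter> children I' = {}" if "I \<in> L k" "I' \<in> L k" "I \<noteq> I'" for I I'
  proof -
    have False if "J \<in> children I" "J \<in> children I'" for J
    proof -
      have "J \<in> L (Suc k)" "J \<subseteq> I" "J \<subseteq> I'"
        using that \<open>I \<in> L k\<close> \<open>I' \<in> L k\<close> by (auto simp: children_layer)
      moreover have "J \<noteq> {}"
        using layer_arc[OF \<open>J \<in> L (Suc k)\<close>] by (auto simp: is_arc_def)
      ultimately show False
        using layer_eq[OF \<open>I \<in> L k\<close> \<open>I' \<in> L k\<close>] \<open>I \<noteq> I'\<close> by blast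
    qed
    then show ?thesis by blast
  qed
  ultimately show ?thesis
    by (simp add: sum.UNION_disjoint finite_layer finite_children layer_in_D)
qed

text \<open>The recursion along the tree reorders the sum over layers; for \<open>k = 0\<close> the left side has a single
  term.\<close>

lemma sum_tree_sum:
  "(\<Sum>I\<in>L k. tree_sum children a n I) = (\<Sum>j<n. \<Sum>I\<in>L (k + j). a I)"
proof (induction n arbitrary: k)
  case (Suc n)
  have "(\<Sum>I\<in>L k. tree_sum children a (Suc n) I)
      = (\<Sum>I\<in>L k. a I) + (\<Sum>J\<in>L (Suc k). tree_sum children a n J)"
    by (simp add: sum.distrib sum_children)
  also have "\<dots> = (\<Sum>j<Suc n. \<Sum>I\<in>L (k + j). a I)"
    by (simp add: Suc sum.lessThan_Suc_shift del: sum.lessThan_Suc)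
  finally show ?case .
qed simp

lemma sets_box [measurable]: "I \<in> D \<Longrightarrow> carleson_box I \<in> sets dA" "I \<in> D \<Longrightarrow> carleson_up I \<in> sets dA"
  using D_arc D_len box_sets_dA by auto

lemma up_subset_box: "I \<in> D \<Longrightarrow> carleson_up I \<subseteq> carleson_box I"
  using D_len(1) carleson_up_subset by auto

text \<open>The points of \<open>Q\<^sub>I\<close> above half height lie over one of the two halves of \<open>I\<close>, and half the height of
  \<open>Q\<^sub>I\<close> is exactly the height of the boxes over these halves.\<close>

lemma indicator_box_split:
  assumes I: "I \<in> D"
  shows "(indicator (carleson_box I) z :: ennreal)
    = indicator (carleson_up I) z + (\<Sum>J\<in>children I. indicator (carleson_box J) z)"
proof -
  obtain k where k: "I \<in> L k" using I by (auto simp: D_def)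
  obtain J K where JK: "J \<in> L (Suc k)" "K \<in> L (Suc k)" "J \<noteq> K" "I = J \<union> K"
    using layer_halves[OF k] by blast
  have ch: "children I = {J, K}"
  proof -
    have "M = J \<or> M = K" if M: "M \<in> L (Suc k)" "M \<subseteq> I" for M
    proof -
      obtain x where "x \<in> M" using layer_arc[OF M(1)] by (auto simp: is_arc_def)
      then show ?thesis using M JK layer_eq[of M "Suc k"] by blast
    qed
    then show ?thesis using JK k by (auto simp: children_layer)
  qed
  have len: "arc_len J = arc_len I / 2" "arc_len K = arc_len I / 2" "0 < arc_len I"
    using JK k layer_len by auto
  have dis: "J \<inter> K = {}" using JK layer_eq by blast
  have "(\<Sum>M\<in>children I. indicator (carleson_box M) z)
      = (indicator (carleson_box J) z + indicator (carleson_box K) z :: ennreal)"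
    using JK(3) by (simp add: ch)
  moreover have "z \<in> carleson_box I \<longleftrightarrow> z \<in> carleson_up I \<or> z \<in> carleson_box J \<or> z \<in> carleson_box K"
    using JK(4) len by (auto simp: carleson_box_def carleson_up_def)
  moreover have "\<not> (z \<in> carleson_box J \<and> z \<in> carleson_box K)"
    using dis by (auto simp: carleson_box_def)
  moreover have "\<not> (z \<in> carleson_up I \<and> z \<in> carleson_box J)" "\<not> (z \<in> carleson_up I \<and> z \<in> carleson_box K)"
    using len by (auto simp: carleson_box_def carleson_up_def)
  ultimately show ?thesis by (auto split: split_indicator)
qed

lemma mass_box_split:
  assumes I: "I \<in> D" and h: "h \<in> borel_measurable dA"
  shows "mass h (carleson_box I) = mass h (carleson_up I) + (\<Sum>J\<in>children I. mass h (carleson_box J))"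
proof -
  have "mass h (carleson_box I) = (\<integral>\<^sup>+z. h z * indicator (carleson_up I) z
      + (\<Sum>J\<in>children I. h z * indicator (carleson_box J) z) \<partial>dA)"
    unfolding mass_def indicator_box_split[OF I] by (simp add: sum_distrib_left distrib_left)
  also have "\<dots> = mass h (carleson_up I) + (\<Sum>J\<in>children I. mass h (carleson_box J))"
    unfolding mass_def using h children_in_D[of I] I sets_box
    by (subst nn_integral_add) (auto intro!: borel_measurable_sum nn_integral_sum)
  finally show ?thesis .
qed

lemma up_unique:
  assumes "I \<in> D" "J \<in> D" "z \<in> carleson_up I" "z \<in> carleson_up J"
  shows "I = J"
proof -
  obtain k j where k: "I \<in> L k" "J \<in> L j" using assms by (auto simp: D_def)
  have "k = j"
  proof (rule ccontr)
    have *: False if "I \<in> L k" "J \<in> L j" "z \<in> carleson_up I" "z \<in> carleson_up J" "k < j" for I J k j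
    proof -
      have "(1::real) / 2 ^ j \<le> 1 / 2 ^ Suc k"
        using that(5) by (intro divide_left_mono power_increasing) auto
      then show False using that by (auto simp: carleson_up_def layer_len)
    qed
    assume "k \<noteq> j"
    then show False using * assms k by (metis nat_neq_iff)
  qed
  then show ?thesis using assms k layer_eq[of I k J] by (auto simp: carleson_up_def)
qed

text \<open>The layer is found from the distance of \<open>z\<close> to the circle, which lies in exactly one of the
  intervals \<open>(2 powr - (k + 1), 2 powr - k]\<close>.\<close>

lemma up_exists:
  assumes z: "z \<noteq> 0" "cmod z < 1"
  shows "\<exists>k. \<exists>I\<in>L k. z \<in> carleson_up I"
proof -
  have "\<exists>n. (1/2::real) ^ n < 1 - cmod z"
    using z by (intro real_arch_pow_inv) auto
  then obtain n where n: "(1/2::real) ^ n < 1 - cmod z" by blast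
  define m where "m = (LEAST n. (1/2::real) ^ n < 1 - cmod z)"
  have m: "(1/2::real) ^ m < 1 - cmod z" unfolding m_def using n by (rule LeastI)
  have "m \<noteq> 0"
  proof
    assume "m = 0"
    with m have "1 < 1 - cmod z" by simp
    then show False by (smt (verit) norm_ge_zero)
  qed
  then obtain k where k: "m = Suc k" by (cases m) auto
  have "\<not> (1/2::real) ^ k < 1 - cmod z"
    using not_less_Least[of k "\<lambda>n. (1/2::real) ^ n < 1 - cmod z"] k by (auto simp: m_def)
  then have k2: "1 - cmod z \<le> 1 / 2 ^ k" "1 / 2 ^ k / 2 < 1 - cmod z"
    using m k by (auto simp: power_one_over)
  have "z / of_real (cmod z) \<in> sphere 0 1" using z by (simp add: norm_divide)
  then obtain I where I: "I \<in> L k" "z / of_real (cmod z) \<in> I"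
    using union_layer[of k] by blast
  then show ?thesis using k2 z layer_len[OF I(1)] by (auto simp: carleson_up_def intro!: bexI[of _ I] exI[of _ k])
qed

lemma tile_value:
  fixes b :: "complex set \<Rightarrow> ennreal"
  assumes I: "I \<in> L k" "z \<in> carleson_up I"
  shows "(\<Sum>j. \<Sum>J\<in>L j. b J * indicator (carleson_up J) z) = b I"
proof -
  have 0: "(\<Sum>J\<in>L j. b J * indicator (carleson_up J) z) = (if j = k then b I else 0)" for j
  proof (cases "j = k")
    case True
    have "(\<Sum>J\<in>L j. b J * indicator (carleson_up J) z) = (\<Sum>J\<in>L j. if J = I then b I else 0)"
      using I True up_unique[of I _ z] layer_in_D by (intro sum.cong) (auto simp: indicator_def)
    then show ?thesis using True I finite_layer by simp
  next
    case False
    have "z \<notin> carleson_up J" if "J \<in> L j" for J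
      using False I that up_unique layer_in_D layer_unique by metis
    then have "(\<Sum>J\<in>L j. b J * indicator (carleson_up J) z) = 0"
      by (intro sum.neutral) (auto simp: indicator_def)
    then show ?thesis using False by simp
  qed
  show ?thesis unfolding 0 by (subst suminf_finite[of "{k}"]) auto
qed

lemma AE_nonzero: "AE z in dA. z \<noteq> 0"
proof -
  have "{0} \<in> null_sets dA"
  proof (rule null_setsI)
    interpret finite_measure dA by (rule finite_measure_dA)
    show "{0} \<in> sets dA" by (rule borel_in_sets_dA) auto
    show "emeasure dA {0} = 0"
      by (simp add: emeasure_eq_measure measure_dA)
  qed
  then show ?thesis by (auto intro: AE_I')
qed

lemma nn_integral_tiles:
  assumes h: "h \<in> borel_measurable dA"
  shows "(\<integral>\<^sup>+z. h z \<partial>dA) = (\<Sum>k. \<Sum>I\<in>L k. mass h (carleson_up I))"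
proof -
  have "(\<integral>\<^sup>+z. h z \<partial>dA) = (\<integral>\<^sup>+z. (\<Sum>k. \<Sum>I\<in>L k. h z * indicator (carleson_up I) z) \<partial>dA)"
  proof (rule nn_integral_cong_AE, rule AE_mp[OF AE_nonzero], rule AE_I2, rule impI)
    fix z assume "z \<in> space dA" "z \<noteq> 0"
    then obtain k I where "I \<in> L k" "z \<in> carleson_up I"
      using up_exists[of z] by (auto simp: space_dA)
    then show "h z = (\<Sum>k. \<Sum>I\<in>L k. h z * indicator (carleson_up I) z)"
      using tile_value[of I k z "\<lambda>_. h z"] by simp
  qed
  also have "\<dots> = (\<Sum>k. \<integral>\<^sup>+z. (\<Sum>I\<in>L k. h z * indicator (carleson_up I) z) \<partial>dA)"
    using h sets_box layer_in_D by (intro nn_integral_suminf borel_measurable_sum) auto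
  also have "\<dots> = (\<Sum>k. \<Sum>I\<in>L k. mass h (carleson_up I))"
    unfolding mass_def using h sets_box layer_in_D
    by (intro suminf_cong nn_integral_sum) auto
  finally show ?thesis .
qed

lemma measure_box: "I \<in> D \<Longrightarrow> measure dA (carleson_box I) \<le> 4 * measure dA (carleson_up I)"
  using measure_box_le_up D_arc D_len by auto

end

lemma dyadic_systemE:
  assumes "dyadic_system D"
  obtains L where "dyadic_layers L" "D = dyadic_layers.D L"
proof -
  obtain L where L: "D = (\<Union>k. L k)"
     "\<forall>k. card (L k) = 2 ^ k \<and> disjoint (L k) \<and> \<Union> (L k) = sphere 0 1"
     "\<forall>k. \<forall>I\<in>L k. is_arc I \<and> arc_len I = 1 / 2 ^ k"
     "\<forall>k. \<forall>I\<in>L k. \<exists>J\<in>L (Suc k). \<exists>K\<in>L (Suc k). J \<noteq> K \<and> I = J \<union> K"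
    using assms unfolding dyadic_system_def by blast
  have "dyadic_layers L" by unfold_locales (use L in auto)
  with L(1) show thesis by (intro that[of L]) (auto simp: dyadic_layers.D_def)
qed

section \<open>Discretization of the maximal operator\<close>

lemma term_le_suminf: "f k \<le> (\<Sum>k. f k :: ennreal)"
  using sum_le_suminf[of f "{k}"] by auto

context dyadic_layers
begin

text \<open>A box touches the circle, where local integrability says nothing, but its upper half has compact
  closure in the disc. The doubling condition carries finiteness over to the box.\<close>

lemma B_infE:
  assumes "\<eta> \<in> B_inf D"
  obtains C where "C > 1" "\<eta> \<in> borel_measurable dA"
    "\<And>I. I \<in> D \<Longrightarrow> mass \<eta> (carleson_box I) \<le> ennreal C * mass \<eta> (carleson_up I)"
    "\<And>I. I \<in> D \<Longrightarrow> mass \<eta> (carleson_box I) < \<infinity>"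
proof -
  obtain C where C: "C > 1" "\<And>I. I \<in> D \<Longrightarrow> mass \<eta> (carleson_box I) \<le> ennreal C * mass \<eta> (carleson_up I)"
    and w: "weight \<eta>"
    using assms by (auto simp: B_inf_def)
  have "mass \<eta> (carleson_box I) < \<infinity>" if I: "I \<in> D" for I
  proof -
    have "mass \<eta> (carleson_up I) \<le> mass \<eta> (cball 0 (1 - arc_len I / 2))"
      by (rule mass_mono) (auto simp: carleson_up_def)
    also have "\<dots> < \<infinity>"
      using w D_len(1)[OF I] unfolding weight_def mass_def by (auto simp: subset_iff)
    finally have "ennreal C * mass \<eta> (carleson_up I) < \<infinity>"
      by (simp add: ennreal_mult_less_top)
    with C(2)[OF I] show ?thesis by (rule le_less_trans)
  qed
  with C w show thesis by (intro that[of C]) (auto simp: weight_def)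
qed

definition box_average :: "real \<Rightarrow> (complex \<Rightarrow> complex) \<Rightarrow> complex set \<Rightarrow> ennreal" where
  "box_average t f I = mass (\<lambda>z. ennreal (cmod (f z))) (carleson_box I)
     / ennreal (measure dA (carleson_box I) powr t)"

definition box_sum :: "real \<Rightarrow> real \<Rightarrow> (complex \<Rightarrow> ennreal) \<Rightarrow> (complex \<Rightarrow> complex) \<Rightarrow> ennreal" where
  "box_sum q t \<mu> f = (\<Sum>k. \<Sum>I\<in>L k. epowr (box_average t f I) q * mass \<mu> (carleson_box I))"

lemma maximal_eq: "maximal t D f z = (SUP I\<in>D. box_average t f I * indicator (carleson_box I) z)"
proof (rule antisym)
  show "maximal t D f z \<le> (SUP I\<in>D. box_average t f I * indicator (carleson_box I) z)"
    unfolding maximal_def box_average_def mass_def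
    by (intro SUP_least) (auto intro!: SUP_upper2)
  show "(SUP I\<in>D. box_average t f I * indicator (carleson_box I) z) \<le> maximal t D f z"
    unfolding maximal_def box_average_def mass_def
    by (intro SUP_least) (auto intro!: SUP_upper2 simp: indicator_def)
qed

lemma maximal_measurable: "maximal t D f \<in> borel_measurable dA"
proof -
  have "(\<lambda>z. SUP I\<in>D. box_average t f I * indicator (carleson_box I) z) \<in> borel_measurable dA"
    using countable_D by (intro borel_measurable_SUP) auto
  then show ?thesis by (simp add: maximal_eq[abs_def])
qed

text \<open>The supremum over the boxes containing a point is dominated by the sum over them.\<close>

lemma maximal_le_box_sum:
  assumes q: "q > 0" and \<mu>: "\<mu> \<in> borel_measurable dA"
  shows "(\<integral>\<^sup>+z. epowr (maximal t D f z) q * \<mu> z \<partial>dA) \<le> box_sum q t \<mu> f"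
proof -
  define c where "c I = epowr (box_average t f I) q" for I
  define S where "S z = (\<Sum>k. \<Sum>I\<in>L k. c I * indicator (carleson_box I) z)" for z
  have "epowr (maximal t D f z) q \<le> S z" for z
  proof -
    have "maximal t D f z \<le> epowr (S z) (1 / q)"
      unfolding maximal_eq
    proof (rule SUP_least)
      fix I assume "I \<in> D"
      then obtain k where k: "I \<in> L k" by (auto simp: D_def)
      show "box_average t f I * indicator (carleson_box I) z \<le> epowr (S z) (1 / q)"
      proof (cases "z \<in> carleson_box I")
        case True
        have "c I \<le> (\<Sum>I\<in>L k. c I * indicator (carleson_box I) z)"
          using member_le_sum[of I "L k" "\<lambda>I. c I * indicator (carleson_box I) z"] k True finite_layer
          by auto
        also have "\<dots> \<le> S z" unfolding S_def by (rule term_le_suminf)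
        finally have "epowr (c I) (1 / q) \<le> epowr (S z) (1 / q)"
          using q by (intro epowr_mono) auto
        then show ?thesis using True q by (simp add: c_def epowr_inverse)
      qed simp
    qed
    then have "epowr (maximal t D f z) q \<le> epowr (epowr (S z) (1 / q)) q"
      using q by (intro epowr_mono) auto
    then show ?thesis using q by (simp add: epowr_inverse')
  qed
  then have "(\<integral>\<^sup>+z. epowr (maximal t D f z) q * \<mu> z \<partial>dA) \<le> (\<integral>\<^sup>+z. S z * \<mu> z \<partial>dA)"
    by (intro nn_integral_mono mult_right_mono) auto
  also have "\<dots> = (\<integral>\<^sup>+z. (\<Sum>k. \<Sum>I\<in>L k. c I * (\<mu> z * indicator (carleson_box I) z)) \<partial>dA)"
    unfolding S_def ennreal_suminf_multc[symmetric] sum_distrib_right by (simp add: mult_ac)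
  also have "\<dots> = (\<Sum>k. \<integral>\<^sup>+z. (\<Sum>I\<in>L k. c I * (\<mu> z * indicator (carleson_box I) z)) \<partial>dA)"
    using \<mu> sets_box layer_in_D by (intro nn_integral_suminf borel_measurable_sum) auto
  also have "\<dots> = (\<Sum>k. \<Sum>I\<in>L k. c I * mass \<mu> (carleson_box I))"
    unfolding mass_def using \<mu> sets_box layer_in_D
    by (intro suminf_cong, subst nn_integral_sum) (auto intro!: sum.cong nn_integral_cmult)
  finally show ?thesis by (simp add: box_sum_def c_def)
qed

text \<open>On the upper half of \<open>Q\<^sub>I\<close> the maximal function is at least the average over \<open>Q\<^sub>I\<close>, and the upper
  halves are disjoint.\<close>

lemma box_sum_le_maximal:
  assumes q: "q > 0" and \<mu>: "\<mu> \<in> borel_measurable dA"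
    and C: "\<And>I. I \<in> D \<Longrightarrow> mass \<mu> (carleson_box I) \<le> ennreal C * mass \<mu> (carleson_up I)"
  shows "box_sum q t \<mu> f \<le> ennreal C * (\<integral>\<^sup>+z. epowr (maximal t D f z) q * \<mu> z \<partial>dA)"
proof -
  define h where "h z = epowr (maximal t D f z) q * \<mu> z" for z
  have h: "h \<in> borel_measurable dA"
    unfolding h_def using \<mu> maximal_measurable by measurable
  have *: "epowr (box_average t f I) q * mass \<mu> (carleson_box I) \<le> ennreal C * mass h (carleson_up I)"
    if I: "I \<in> D" for I
  proof -
    have "epowr (box_average t f I) q * mass \<mu> (carleson_up I)
        = (\<integral>\<^sup>+z. epowr (box_average t f I) q * (\<mu> z * indicator (carleson_up I) z) \<partial>dA)"
      unfolding mass_def using \<mu> I sets_box by (subst nn_integral_cmult) auto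
    also have "\<dots> \<le> mass h (carleson_up I)"
      unfolding mass_def
    proof (intro nn_integral_mono)
      fix z
      have "epowr (box_average t f I) q \<le> epowr (maximal t D f z) q" if "z \<in> carleson_up I"
        using that I up_subset_box[OF I] q unfolding maximal_eq
        by (intro epowr_mono SUP_upper2[of I]) auto
      then show "epowr (box_average t f I) q * (\<mu> z * indicator (carleson_up I) z)
          \<le> h z * indicator (carleson_up I) z"
        by (auto simp: h_def indicator_def mult_right_mono)
    qed
    finally have 1: "epowr (box_average t f I) q * mass \<mu> (carleson_up I) \<le> mass h (carleson_up I)" .
    have "epowr (box_average t f I) q * mass \<mu> (carleson_box I)
        \<le> epowr (box_average t f I) q * (ennreal C * mass \<mu> (carleson_up I))"
      using C[OF I] by (rule mult_left_mono) simp
    also have "\<dots> = ennreal C * (epowr (box_average t f I) q * mass \<mu> (carleson_up I))"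
      by (simp add: mult_ac)
    also have "\<dots> \<le> ennreal C * mass h (carleson_up I)"
      using 1 by (rule mult_left_mono) simp
    finally show ?thesis .
  qed
  have "box_sum q t \<mu> f \<le> (\<Sum>k. ennreal C * (\<Sum>I\<in>L k. mass h (carleson_up I)))"
    unfolding box_sum_def sum_distrib_left using * layer_in_D
    by (intro suminf_le sum_mono) auto
  also have "\<dots> = ennreal C * (\<integral>\<^sup>+z. h z \<partial>dA)"
    by (simp add: nn_integral_tiles[OF h])
  finally show ?thesis by (simp add: h_def)
qed

lemma bounded_iff_box_sum:
  assumes q: "q > 0" and \<mu>: "\<mu> \<in> B_inf D"
  shows "bounded_Lp_Lq p \<omega> (ereal q) \<mu> (maximal t D) \<longleftrightarrow>
    (\<exists>K\<ge>0. \<forall>f\<in>borel_measurable dA. Lp_norm p \<omega> (\<lambda>z. ennreal (cmod (f z))) < \<infinity> \<longrightarrow>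
       box_sum q t \<mu> f \<le> ennreal K * epowr (Lp_norm p \<omega> (\<lambda>z. ennreal (cmod (f z)))) q)"
    (is "?L \<longleftrightarrow> ?R")
proof -
  obtain C where C: "C > 1" "\<mu> \<in> borel_measurable dA"
    "\<And>I. I \<in> D \<Longrightarrow> mass \<mu> (carleson_box I) \<le> ennreal C * mass \<mu> (carleson_up I)"
    using B_infE[OF \<mu>] by metis
  define N where "N f = Lp_norm p \<omega> (\<lambda>z. ennreal (cmod (f z)))" for f :: "complex \<Rightarrow> complex"
  define T where "T f = (\<integral>\<^sup>+z. epowr (maximal t D f z) q * \<mu> z \<partial>dA)" for f
  have norm_T: "Lp_norm (ereal q) \<mu> (maximal t D f) = epowr (T f) (1 / q)" for f
    by (simp add: Lp_norm_def T_def)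
  have in_Lp: "(\<lambda>z. ennreal (cmod (f z))) \<in> Lp p \<omega> \<longleftrightarrow> N f < \<infinity>" if "f \<in> borel_measurable dA" for f
    using that by (simp add: Lp_def N_def)
  show ?thesis
  proof
    assume ?L
    then obtain B where B: "B \<ge> 0"
      "\<And>f. f \<in> borel_measurable dA \<Longrightarrow> N f < \<infinity> \<Longrightarrow> epowr (T f) (1 / q) \<le> ennreal B * N f"
      unfolding bounded_Lp_Lq_def using in_Lp norm_T N_def by metis
    have "box_sum q t \<mu> f \<le> ennreal (C * B powr q) * epowr (N f) q"
      if f: "f \<in> borel_measurable dA" "N f < \<infinity>" for f
    proof -
      obtain n where n: "N f = ennreal n" "n \<ge> 0" using f(2) by (cases "N f") auto
      have "epowr (epowr (T f) (1 / q)) q \<le> epowr (ennreal B * N f) q"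
        using B(2)[OF f] q by (intro epowr_mono)
      then have "T f \<le> ennreal (B powr q * n powr q)"
        using q B(1) n by (simp add: epowr_inverse' epowr_ennreal powr_mult flip: ennreal_mult)
      then have "ennreal C * T f \<le> ennreal C * ennreal (B powr q * n powr q)"
        by (intro mult_left_mono) auto
      also have "\<dots> = ennreal (C * B powr q) * epowr (N f) q"
        using C(1) n q by (simp add: epowr_ennreal mult.assoc flip: ennreal_mult)
      finally show ?thesis
        using box_sum_le_maximal[OF q C(2,3), of t f] unfolding T_def[symmetric] by simp
    qed
    then show ?R using C(1) unfolding N_def by (intro exI[of _ "C * B powr q"]) auto
  next
    assume ?R
    then obtain K where K: "K \<ge> 0"
      "\<And>f. f \<in> borel_measurable dA \<Longrightarrow> N f < \<infinity> \<Longrightarrow> box_sum q t \<mu> f \<le> ennreal K * epowr (N f) q"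
      unfolding N_def by blast
    have *: "epowr (T f) (1 / q) \<le> ennreal (K powr (1 / q)) * N f"
      if f: "f \<in> borel_measurable dA" "N f < \<infinity>" for f
    proof -
      obtain n where n: "N f = ennreal n" "n \<ge> 0" using f(2) by (cases "N f") auto
      have "T f \<le> ennreal K * epowr (N f) q"
        using maximal_le_box_sum[OF q C(2), of t f] K(2)[OF f] unfolding T_def by simp
      then have "epowr (T f) (1 / q) \<le> epowr (ennreal K * epowr (N f) q) (1 / q)"
        using q by (intro epowr_mono) auto
      also have "\<dots> = ennreal (K powr (1 / q)) * N f"
        using q K(1) n by (simp add: epowr_ennreal powr_mult powr_powr flip: ennreal_mult)
      finally show ?thesis .
    qed
    show ?L
      unfolding bounded_Lp_Lq_def
    proof (intro exI[of _ "K powr (1 / q)"] conjI ballI impI)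
      fix f assume f: "f \<in> borel_measurable dA" "(\<lambda>z. ennreal (cmod (f z))) \<in> Lp p \<omega>"
      then have N: "N f < \<infinity>" using in_Lp by blast
      show "Lp_norm (ereal q) \<mu> (maximal t D f) \<le> ennreal (K powr (1 / q)) * Lp_norm p \<omega> (\<lambda>z. ennreal (cmod (f z)))"
        using *[OF f(1) N] by (simp add: norm_T N_def)
      then show "maximal t D f \<in> Lp (ereal q) \<mu>"
        using N maximal_measurable unfolding Lp_def N_def[symmetric]
        by (auto simp: ennreal_mult_less_top intro: le_less_trans)
    qed simp
  qed
qed

end

section \<open>Discretization of the testing function\<close>

context dyadic_layers
begin

text \<open>The numbers \<open>\<lambda>\<^sub>I\<close> of the introduction, with \<open>e = q / p'\<close>. A box of area zero gets the value \<open>0\<close>, since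
  \<open>0 powr x = 0\<close>.\<close>

definition testing_coef ::
  "real \<Rightarrow> real \<Rightarrow> real \<Rightarrow> (complex \<Rightarrow> ennreal) \<Rightarrow> (complex \<Rightarrow> ennreal) \<Rightarrow> complex set \<Rightarrow> real" where
  "testing_coef q t e \<mu> \<sigma> I = measure dA (carleson_box I) powr (- t * q) * enn2real (mass \<mu> (carleson_box I))
     * enn2real (mass \<sigma> (carleson_box I)) powr e"

lemma testing_coef_nonneg: "testing_coef q t e \<mu> \<sigma> I \<ge> 0"
  by (simp add: testing_coef_def)

text \<open>The relation between the exponents holds for \<open>r = p / (p - q)\<close> and is what turns
  \<open>\<beta>\<^sub>I * |Q\<^sub>I| powr (1 / r)\<close> into \<open>\<lambda>\<^sub>I\<close>.\<close>

lemma phi_in_Lp_iff: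
  assumes r: "phi_exp p q > 0" and e: "q / conj_exp p > 0"
    and rel: "1 / phi_exp p q = 1 - q + q / conj_exp p"
    and \<mu>: "\<mu> \<in> B_inf D" and \<sigma>: "\<sigma> \<in> B_inf D"
  shows "phi p q t D \<mu> \<sigma> \<in> Lp (ereal (phi_exp p q)) (\<lambda>_. 1) \<longleftrightarrow>
    (\<Sum>k. \<Sum>I\<in>L k. ennreal (testing_coef q t (q / conj_exp p) \<mu> \<sigma> I powr phi_exp p q)) < \<infinity>"
proof -
  define r where "r = phi_exp p q"
  define e where "e = q / conj_exp p"
  define a where "a I = measure dA (carleson_box I)" for I
  define m where "m I = enn2real (mass \<mu> (carleson_box I))" for I
  define s where "s I = enn2real (mass \<sigma> (carleson_box I))" for I
  define b where "b I = (1 / a I powr ((t - 1) * q)) * (m I / a I) * (s I / a I) powr e" for I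
  have r0: "r > 0" and e0: "e > 0" using r e by (auto simp: r_def e_def)
  have mI: "mass \<mu> (carleson_box I) = ennreal (m I)" if "I \<in> D" for I
    using that \<mu> unfolding m_def by (auto elim!: B_infE simp: less_top)
  have sI: "mass \<sigma> (carleson_box I) = ennreal (s I)" if "I \<in> D" for I
    using that \<sigma> unfolding s_def by (auto elim!: B_infE simp: less_top)
  have nonneg: "0 \<le> a I" "0 \<le> m I" "0 \<le> s I" "0 \<le> b I" for I
    by (auto simp: a_def m_def s_def b_def)
  have beta: "beta p q t \<mu> \<sigma> I = ennreal (b I)" if I: "I \<in> D" for I
  proof (cases "a I = 0")
    case True
    then have "mass \<mu> (carleson_box I) = 0" "m I = 0"
      using mass_null[of "carleson_box I" \<mu>] I sets_box by (auto simp: a_def m_def)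
    then show ?thesis by (simp add: beta_def b_def Let_def)
  next
    case False
    then have "a I > 0" using nonneg(1)[of I] by simp
    then show ?thesis
      using nonneg[of I] e0 mI[OF I] sI[OF I]
      by (simp add: beta_def b_def Let_def e_def[symmetric] a_def[symmetric] divide_ennreal epowr_ennreal
          flip: ennreal_mult)
  qed
  have b_coef: "b I powr r * a I = testing_coef q t e \<mu> \<sigma> I powr r" if I: "I \<in> D" for I
  proof (cases "a I = 0")
    case True
    then show ?thesis by (simp add: testing_coef_def a_def)
  next
    case False
    then have a: "a I > 0" using nonneg(1)[of I] by simp
    have "b I = testing_coef q t e \<mu> \<sigma> I * a I powr (- (t - 1) * q - 1 - e + t * q)"
      using a nonneg[of I]
      by (simp add: b_def testing_coef_def a_def[symmetric] m_def[symmetric] s_def[symmetric]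
          powr_divide powr_add powr_diff powr_minus field_simps)
    also have "- (t - 1) * q - 1 - e + t * q = - (1 / r)"
      using rel by (simp add: r_def e_def algebra_simps)
    finally have "b I powr r = testing_coef q t e \<mu> \<sigma> I powr r * (a I powr (- (1 / r))) powr r"
      using testing_coef_nonneg by (simp add: powr_mult)
    also have "(a I powr (- (1 / r))) powr r = 1 / a I"
    proof -
      have "(a I powr (- (1 / r))) powr r = a I powr (- (1 / r) * r)" by (rule powr_powr)
      also have "- (1 / r) * r = - 1" using r0 by simp
      finally show ?thesis using a by (simp add: powr_minus_divide)
    qed
    finally show ?thesis using a by simp
  qed
  define ph where "ph = phi p q t D \<mu> \<sigma>"
  have ph_up: "ph z = ennreal (b I)" if I: "I \<in> D" "z \<in> carleson_up I" for I z
  proof -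
    have "z \<notin> carleson_up J" if "J \<in> D" "J \<noteq> I" for J
      using up_unique[OF I(1) that(1) I(2)] that(2) by blast
    then have "ph z = (\<Sum>\<^sub>\<infinity>J\<in>{I}. beta p q t \<mu> \<sigma> J * indicator (carleson_up J) z)"
      unfolding ph_def phi_def using I
      by (intro infsum_cong_neutral) (auto simp: indicator_def)
    then show ?thesis using I beta by simp
  qed
  have ph_eq: "ph z = (\<Sum>k. \<Sum>I\<in>L k. ennreal (b I) * indicator (carleson_up I) z)" for z
  proof (cases "\<exists>I\<in>D. z \<in> carleson_up I")
    case True
    then obtain k I where I: "I \<in> L k" "z \<in> carleson_up I" by (auto simp: D_def)
    then show ?thesis
      using tile_value[OF I, of "\<lambda>I. ennreal (b I)"] ph_up layer_in_D by simp
  next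
    case False
    have "ph z = 0" unfolding ph_def phi_def using False
      by (intro infsum_0) (auto simp: indicator_def)
    moreover have "(\<Sum>I\<in>L k. ennreal (b I) * indicator (carleson_up I) z) = 0" for k
      using False layer_in_D by (intro sum.neutral) (auto simp: indicator_def)
    ultimately show ?thesis by simp
  qed
  have ph_meas: "ph \<in> borel_measurable dA"
    unfolding ph_eq[abs_def] using sets_box layer_in_D
    by (intro borel_measurable_suminf_order borel_measurable_sum) auto
  interpret finite_measure dA by (rule finite_measure_dA)
  define S where "S = (\<Sum>k. \<Sum>I\<in>L k. ennreal (testing_coef q t e \<mu> \<sigma> I powr r))"
  have mass_ph: "mass (\<lambda>z. epowr (ph z) r) (carleson_up I) = ennreal (b I powr r * measure dA (carleson_up I))"
    if I: "I \<in> D" for I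
  proof -
    have "mass (\<lambda>z. epowr (ph z) r) (carleson_up I)
        = (\<integral>\<^sup>+z. ennreal (b I powr r) * indicator (carleson_up I) z \<partial>dA)"
      unfolding mass_def using ph_up[OF I] r0 nonneg[of I]
      by (intro nn_integral_cong) (auto simp: indicator_def epowr_ennreal)
    also have "\<dots> = ennreal (b I powr r) * emeasure dA (carleson_up I)"
      using I sets_box by (intro nn_integral_cmult_indicator)
    finally show ?thesis by (simp add: emeasure_eq_measure ennreal_mult)
  qed
  have int: "(\<integral>\<^sup>+z. epowr (ph z) r \<partial>dA) = (\<Sum>k. \<Sum>I\<in>L k. ennreal (b I powr r * measure dA (carleson_up I)))"
    using nn_integral_tiles[of "\<lambda>z. epowr (ph z) r"] ph_meas mass_ph layer_in_D by (simp cong: sum.cong)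
  have up: "b I powr r * measure dA (carleson_up I) \<le> testing_coef q t e \<mu> \<sigma> I powr r"
    "testing_coef q t e \<mu> \<sigma> I powr r \<le> 4 * (b I powr r * measure dA (carleson_up I))" if I: "I \<in> D" for I
  proof -
    have "measure dA (carleson_up I) \<le> a I"
      unfolding a_def using I up_subset_box sets_box by (intro finite_measure_mono) auto
    then have "b I powr r * measure dA (carleson_up I) \<le> b I powr r * a I"
      by (intro mult_left_mono) auto
    then show "b I powr r * measure dA (carleson_up I) \<le> testing_coef q t e \<mu> \<sigma> I powr r"
      by (simp add: b_coef[OF I])
    have "b I powr r * a I \<le> b I powr r * (4 * measure dA (carleson_up I))"
      using measure_box[OF I] unfolding a_def by (intro mult_left_mono) auto
    then show "testing_coef q t e \<mu> \<sigma> I powr r \<le> 4 * (b I powr r * measure dA (carleson_up I))"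
      by (simp add: b_coef[OF I])
  qed
  have 1: "(\<integral>\<^sup>+z. epowr (ph z) r \<partial>dA) \<le> S"
    unfolding int S_def using up layer_in_D by (intro suminf_le sum_mono ennreal_leI) auto
  have "S \<le> (\<Sum>k. 4 * (\<Sum>I\<in>L k. ennreal (b I powr r * measure dA (carleson_up I))))"
    unfolding S_def sum_distrib_left
  proof (intro suminf_le sum_mono)
    fix k I assume "I \<in> L k"
    then have "ennreal (testing_coef q t e \<mu> \<sigma> I powr r) \<le> ennreal (4 * (b I powr r * measure dA (carleson_up I)))"
      using up layer_in_D by (intro ennreal_leI) auto
    then show "ennreal (testing_coef q t e \<mu> \<sigma> I powr r) \<le> 4 * ennreal (b I powr r * measure dA (carleson_up I))"
      by (simp add: ennreal_mult')
  qed auto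
  then have 2: "S \<le> 4 * (\<integral>\<^sup>+z. epowr (ph z) r \<partial>dA)"
    by (simp add: int)
  have "ph \<in> Lp (ereal r) (\<lambda>_. 1) \<longleftrightarrow> (\<integral>\<^sup>+z. epowr (ph z) r \<partial>dA) < \<infinity>"
    using ph_meas r0 by (simp add: Lp_def Lp_norm_def epowr_less_top)
  also have "\<dots> \<longleftrightarrow> S < \<infinity>"
    using 1 2 by (auto simp: ennreal_mult_less_top intro: le_less_trans)
  finally show ?thesis by (simp add: ph_def r_def S_def e_def)
qed

end

section \<open>Finite exponents\<close>

context dyadic_layers
begin

text \<open>The tree embedding works with real numbers, so the additivity over the children is needed for the
  real values of the masses.\<close>

lemma real_mass_split:
  assumes I: "I \<in> D" and h: "h \<in> borel_measurable dA"
    and fin: "\<And>J. J \<in> D \<Longrightarrow> mass h (carleson_box J) < \<infinity>"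
  shows "enn2real (mass h (carleson_box I)) = enn2real (mass h (carleson_up I))
    + (\<Sum>J\<in>children I. enn2real (mass h (carleson_box J)))"
proof -
  have up: "mass h (carleson_up I) < top"
    using mass_mono[OF up_subset_box[OF I], of h] fin[OF I] by (auto intro: le_less_trans)
  have ch: "mass h (carleson_box J) < top" if "J \<in> children I" for J
    using that children_in_D fin by auto
  show ?thesis
    using up ch unfolding mass_box_split[OF I h]
    by (subst enn2real_plus) (auto simp: ennreal_sum_less_top finite_children[OF I] enn2real_sum)
qed

lemma mass_tangent:
  assumes P: "P > 1" and c: "c \<ge> 0"
    and f: "f \<in> borel_measurable dA" and \<omega>: "\<omega> \<in> borel_measurable dA" and E: "E \<in> sets dA"
  shows "ennreal (P * c powr (P - 1)) * mass (\<lambda>z. ennreal (cmod (f z))) E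
    \<le> mass (\<lambda>z. epowr (ennreal (cmod (f z))) P * \<omega> z) E
      + ennreal ((P - 1) * c powr P) * mass (\<lambda>z. epowr (\<omega> z) (- 1 / (P - 1))) E"
proof -
  note [measurable] = f \<omega> E
  have "ennreal (P * c powr (P - 1)) * mass (\<lambda>z. ennreal (cmod (f z))) E
      = (\<integral>\<^sup>+z. ennreal (P * c powr (P - 1)) * (ennreal (cmod (f z)) * indicator E z) \<partial>dA)"
    unfolding mass_def by (subst nn_integral_cmult) auto
  also have "\<dots> \<le> (\<integral>\<^sup>+z. epowr (ennreal (cmod (f z))) P * \<omega> z * indicator E z
      + ennreal ((P - 1) * c powr P) * (epowr (\<omega> z) (- 1 / (P - 1)) * indicator E z) \<partial>dA)"
    using weight_tangent[OF P c] by (intro nn_integral_mono) (auto simp: indicator_def)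
  also have "\<dots> = mass (\<lambda>z. epowr (ennreal (cmod (f z))) P * \<omega> z) E
      + ennreal ((P - 1) * c powr P) * mass (\<lambda>z. epowr (\<omega> z) (- 1 / (P - 1))) E"
    unfolding mass_def by (subst nn_integral_add) (auto simp: nn_integral_cmult)
  finally show ?thesis .
qed

text \<open>The tree embedding for the masses of \<open>\<sigma>\<close>, \<open>|f|\<close> and \<open>|f|\<^sup>P \<omega>\<close>. The factor \<open>C\<close> arises on passing
  from the full masses \<open>s\<close> to the masses of the upper halves, which are the ones the tree keeps.\<close>

lemma average_embedding:
  fixes P w :: real and \<omega> :: "complex \<Rightarrow> ennreal" and f :: "complex \<Rightarrow> complex"
  defines "\<sigma> \<equiv> (\<lambda>z. epowr (\<omega> z) (- 1 / (P - 1)))"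
  defines "s \<equiv> (\<lambda>I. enn2real (mass \<sigma> (carleson_box I)))"
  assumes P: "P > 1" and \<omega>: "\<omega> \<in> borel_measurable dA"
    and finite_mass: "\<forall>I\<in>D. mass \<sigma> (carleson_box I) < \<infinity>"
    and doubling: "\<forall>I\<in>D. mass \<sigma> (carleson_box I) \<le> ennreal C * mass \<sigma> (carleson_up I)" and C: "C > 0"
    and f: "f \<in> borel_measurable dA"
    and w: "(\<integral>\<^sup>+z. epowr (ennreal (cmod (f z))) P * \<omega> z \<partial>dA) = ennreal w" "w \<ge> 0"
  defines "g \<equiv> (\<lambda>I. enn2real (mass (\<lambda>z. ennreal (cmod (f z))) (carleson_box I)))"
  shows "\<And>I. I \<in> D \<Longrightarrow> mass (\<lambda>z. ennreal (cmod (f z))) (carleson_box I) < \<infinity>"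
    and "\<And>I. I \<in> D \<Longrightarrow> s I = 0 \<Longrightarrow> g I = 0"
    and "(\<Sum>k<n. \<Sum>I\<in>L k. s I * (g I / s I) powr P) \<le> C * (2 powr P / (P - 1) * w)"
proof -
  note fin = bspec[OF finite_mass]
  define af where "af = (\<lambda>z. ennreal (cmod (f z)))"
  define h where "h = (\<lambda>z. epowr (af z) P * \<omega> z)"
  note [measurable] = f \<omega>
  have af_m [measurable]: "af \<in> borel_measurable dA" by (simp add: af_def)
  have h_m [measurable]: "h \<in> borel_measurable dA" by (simp add: h_def)
  have \<sigma>_m [measurable]: "\<sigma> \<in> borel_measurable dA" by (simp add: \<sigma>_def)
  have h_le: "mass h E \<le> ennreal w" for E
    unfolding w(1)[symmetric] mass_def h_def af_def by (intro nn_integral_mono) (auto simp: indicator_def)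
  have h_fin: "mass h E < \<infinity>" for E
    using h_le[of E] by (auto intro: le_less_trans)
  have tangent: "ennreal (P * c powr (P - 1)) * mass af E
      \<le> mass h E + ennreal ((P - 1) * c powr P) * mass \<sigma> E" if "c \<ge> 0" "E \<in> sets dA" for c E
    using mass_tangent[OF P that(1) f \<omega> that(2)] by (simp add: af_def h_def \<sigma>_def)
  have af_fin: "mass af E < \<infinity>" if "mass \<sigma> E < \<infinity>" "E \<in> sets dA" for E
  proof -
    have "ennreal P * mass af E \<le> mass h E + ennreal (P - 1) * mass \<sigma> E"
      using tangent[of 1 E] that by simp
    also have "\<dots> < \<infinity>" using h_fin that by (auto simp: ennreal_mult_less_top)
    finally show ?thesis using P by (auto simp: ennreal_mult_less_top)
  qed
  show fin_af: "mass (\<lambda>z. ennreal (cmod (f z))) (carleson_box I) < \<infinity>" if "I \<in> D" for I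
    using af_fin[OF fin[OF that] sets_box(1)[OF that]] by (simp add: af_def)
  have real_tangent: "P * c powr (P - 1) * enn2real (mass af E)
      \<le> enn2real (mass h E) + (P - 1) * c powr P * enn2real (mass \<sigma> E)"
    if E: "c \<ge> 0" "E \<in> sets dA" "mass \<sigma> E < \<infinity>" for c E
  proof -
    obtain x y z where "mass af E = ennreal x" "x \<ge> 0" "mass h E = ennreal y" "y \<ge> 0"
      "mass \<sigma> E = ennreal z" "z \<ge> 0"
      using af_fin[OF E(3,2)] h_fin[of E] E(3)
      by (cases "mass af E"; cases "mass h E"; cases "mass \<sigma> E") auto
    then show ?thesis
      using tangent[OF E(1,2)] P E(1) by (simp flip: ennreal_mult ennreal_plus)
  qed
  have up_fin: "mass \<sigma> (carleson_up I) < \<infinity>" if "I \<in> D" for I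
    using mass_mono[OF up_subset_box[OF that], of \<sigma>] fin[OF that] by (auto intro: le_less_trans)
  have g_af: "g I = enn2real (mass af (carleson_box I))" for I
    by (simp add: g_def af_def)
  show "g I = 0" if "I \<in> D" "s I = 0" for I
  proof (rule zero_of_powr_bound[OF P])
    show "P * c powr (P - 1) * g I \<le> enn2real (mass h (carleson_box I))" if "c \<ge> 0" for c
      using real_tangent[OF that sets_box(1)[OF \<open>I \<in> D\<close>] fin[OF \<open>I \<in> D\<close>]] \<open>s I = 0\<close> by (simp add: g_af s_def)
  qed (simp add: g_def)
  define s0 where "s0 I = enn2real (mass \<sigma> (carleson_up I))" for I
  have tree: "tree_sum children (\<lambda>I. s0 I * (g I / s I) powr P) n I
      \<le> 2 powr P / (P - 1) * enn2real (mass h (carleson_box I))" if "I \<in> D" for I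
  proof (rule tree_carleson_embedding[where S = D, OF P])
    fix J assume J: "J \<in> D"
    show "s J = s0 J + (\<Sum>K\<in>children J. s K)"
      unfolding s_def s0_def using J fin by (intro real_mass_split) auto
    show "g J = enn2real (mass af (carleson_up J)) + (\<Sum>K\<in>children J. g K)"
      unfolding g_af using J fin_af by (intro real_mass_split) (auto simp: af_def)
    show "enn2real (mass h (carleson_box J)) = enn2real (mass h (carleson_up J))
        + (\<Sum>K\<in>children J. enn2real (mass h (carleson_box K)))"
      using J h_fin by (intro real_mass_split) auto
    fix c :: real assume c: "c \<ge> 0"
    show "P * c powr (P - 1) * enn2real (mass af (carleson_up J))
        \<le> enn2real (mass h (carleson_up J)) + (P - 1) * c powr P * s0 J"
      unfolding s0_def using c J up_fin by (intro real_tangent) auto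
    show "P * c powr (P - 1) * g J
        \<le> enn2real (mass h (carleson_box J)) + (P - 1) * c powr P * s J"
      unfolding s_def g_af using c J fin by (intro real_tangent) auto
  qed (use that children_in_D in \<open>auto simp: s_def s0_def g_def\<close>)
  have s_s0: "s I \<le> C * s0 I" if I: "I \<in> D" for I
    using bspec[OF doubling I] C fin[OF I] up_fin[OF I] unfolding s_def s0_def
    by (cases "mass \<sigma> (carleson_box I)"; cases "mass \<sigma> (carleson_up I)")
      (auto simp flip: ennreal_mult)
  have "(\<Sum>k<n. \<Sum>I\<in>L k. s I * (g I / s I) powr P)
      \<le> (\<Sum>k<n. \<Sum>I\<in>L k. (C * s0 I) * (g I / s I) powr P)"
    using s_s0 layer_in_D by (intro sum_mono mult_right_mono) auto
  also have "\<dots> = C * (\<Sum>I\<in>L 0. tree_sum children (\<lambda>I. s0 I * (g I / s I) powr P) n I)"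
    unfolding sum_tree_sum by (simp add: sum_distrib_left mult.assoc)
  also have "\<dots> \<le> C * (\<Sum>I\<in>L 0. 2 powr P / (P - 1) * enn2real (mass h (carleson_box I)))"
    using tree layer_in_D C by (intro mult_left_mono sum_mono) auto
  also have "\<dots> \<le> C * (\<Sum>I\<in>L 0. 2 powr P / (P - 1) * w)"
    using P C h_le w(2) by (intro mult_left_mono sum_mono) (auto intro!: enn2real_leI)
  also have "\<dots> = C * (2 powr P / (P - 1) * w)"
    by (simp add: card_layer)
  finally show "(\<Sum>k<n. \<Sum>I\<in>L k. s I * (g I / s I) powr P) \<le> C * (2 powr P / (P - 1) * w)" .
qed

lemma box_average_eq:
  assumes I: "I \<in> D"
    and f: "mass (\<lambda>z. ennreal (cmod (f z))) (carleson_box I) = ennreal g" "g \<ge> 0"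
  shows "box_average t f I = ennreal (g / measure dA (carleson_box I) powr t)"
proof (cases "measure dA (carleson_box I) = 0")
  case True
  then have "mass (\<lambda>z. ennreal (cmod (f z))) (carleson_box I) = 0"
    using I sets_box by (intro mass_null) auto
  then show ?thesis using f(2) True by (simp add: box_average_def)
next
  case False
  then have "measure dA (carleson_box I) > 0" by (simp add: less_le)
  then show ?thesis using f by (simp add: box_average_def divide_ennreal)
qed

lemma box_sum_term:
  assumes I: "I \<in> D" and q: "q > 0"
    and f: "mass (\<lambda>z. ennreal (cmod (f z))) (carleson_box I) = ennreal g" "g \<ge> 0"
    and \<mu>: "mass \<mu> (carleson_box I) < \<infinity>"
  shows "epowr (box_average t f I) q * mass \<mu> (carleson_box I)
    = ennreal ((g / measure dA (carleson_box I) powr t) powr q * enn2real (mass \<mu> (carleson_box I)))"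
proof -
  have "mass \<mu> (carleson_box I) = ennreal (enn2real (mass \<mu> (carleson_box I)))"
    using \<mu> by (simp add: less_top)
  then show ?thesis
    using q f(2) box_average_eq[OF I f] by (metis (no_types, lifting) divide_nonneg_nonneg
        ennreal_mult enn2real_nonneg epowr_ennreal powr_ge_zero)
qed

text \<open>The terms of the sum are \<open>\<lambda>\<^sub>I * y\<^sub>I\<close>. Young's inequality with the scale \<open>w = \<integral> |f|\<^sup>P \<omega>\<close> bounds them by
  \<open>w powr (q / P)\<close> times \<open>\<lambda>\<^sub>I powr r + y\<^sub>I powr (P / q) / w\<close>, and the embedding bounds the total of
  the last summands independently of \<open>w\<close>.\<close>

lemma box_sum_le_of_finite_testing:
  fixes q P \<Lambda> :: real and \<omega> :: "complex \<Rightarrow> ennreal"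
  defines "\<sigma> \<equiv> (\<lambda>z. epowr (\<omega> z) (- 1 / (P - 1)))"
  assumes q: "1 \<le> q" "q < P" and \<omega>: "\<omega> \<in> borel_measurable dA"
    and \<mu>: "\<mu> \<in> B_inf D" and \<sigma>: "\<sigma> \<in> B_inf D"
    and \<Lambda>: "(\<Sum>k. \<Sum>I\<in>L k. ennreal (testing_coef q t (q * (1 - 1 / P)) \<mu> \<sigma> I powr (P / (P - q)))) = ennreal \<Lambda>" "\<Lambda> \<ge> 0"
  shows "\<exists>K\<ge>0. \<forall>f\<in>borel_measurable dA. (\<integral>\<^sup>+z. epowr (ennreal (cmod (f z))) P * \<omega> z \<partial>dA) < \<infinity> \<longrightarrow>
    box_sum q t \<mu> f \<le> ennreal K * epowr (\<integral>\<^sup>+z. epowr (ennreal (cmod (f z))) P * \<omega> z \<partial>dA) (q / P)"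
proof -
  obtain C where C: "C > 1" "\<And>I. I \<in> D \<Longrightarrow> mass \<sigma> (carleson_box I) \<le> ennreal C * mass \<sigma> (carleson_up I)"
    and fin_\<sigma>: "\<And>I. I \<in> D \<Longrightarrow> mass \<sigma> (carleson_box I) < \<infinity>"
    using B_infE[OF \<sigma>] by metis
  have fin_\<mu>: "\<And>I. I \<in> D \<Longrightarrow> mass \<mu> (carleson_box I) < \<infinity>"
    using B_infE[OF \<mu>] by metis
  have P: "P > 1" using q by simp
  define e where "e = q * (1 - 1 / P)"
  define r where "r = P / (P - q)"
  define u where "u = P / q"
  have u: "u > 1" "u / (u - 1) = r" "1 / u = q / P" using q by (auto simp: u_def r_def field_simps)
  define lam where "lam I = testing_coef q t e \<mu> \<sigma> I" for I
  have lam0: "lam I \<ge> 0" for I by (simp add: lam_def testing_coef_nonneg)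
  define s where "s I = enn2real (mass \<sigma> (carleson_box I))" for I
  define m where "m I = enn2real (mass \<mu> (carleson_box I))" for I
  define a where "a I = measure dA (carleson_box I)" for I
  have lam_sum: "(\<Sum>k<n. \<Sum>I\<in>L k. lam I powr r) \<le> \<Lambda>" for n
  proof -
    have "(\<Sum>k<n. \<Sum>I\<in>L k. ennreal (lam I powr r)) \<le> ennreal \<Lambda>"
      using \<Lambda>(1) sum_le_suminf[of "\<lambda>k. \<Sum>I\<in>L k. ennreal (lam I powr r)" "{..<n}"]
      by (simp add: lam_def e_def r_def)
    then show ?thesis using \<Lambda>(2) by (simp add: sum_nonneg)
  qed
  define B where "B = C * (2 powr P / (P - 1))"
  have B0: "B \<ge> 0" using C P by (simp add: B_def)
  have "box_sum q t \<mu> f \<le> ennreal (\<Lambda> + B) * epowr (ennreal w) (q / P)"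
    if f: "f \<in> borel_measurable dA"
      and w: "(\<integral>\<^sup>+z. epowr (ennreal (cmod (f z))) P * \<omega> z \<partial>dA) = ennreal w" "w \<ge> 0" for f w
  proof -
    define g where "g I = enn2real (mass (\<lambda>z. ennreal (cmod (f z))) (carleson_box I))" for I
    have C0: "C > 0" using C(1) by simp
    have fin_\<sigma>': "\<forall>I\<in>D. mass (\<lambda>z. epowr (\<omega> z) (- 1 / (P - 1))) (carleson_box I) < \<infinity>"
      and C': "\<forall>I\<in>D. mass (\<lambda>z. epowr (\<omega> z) (- 1 / (P - 1))) (carleson_box I)
        \<le> ennreal C * mass (\<lambda>z. epowr (\<omega> z) (- 1 / (P - 1))) (carleson_up I)"
      using fin_\<sigma> C(2) by (auto simp: \<sigma>_def)
    note emb = average_embedding[OF P \<omega> fin_\<sigma>' C' C0 f w,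
      folded \<sigma>_def, folded s_def g_def]
    define y where "y I = (s I * (g I / s I) powr P) powr (1 / u)" for I
    have sg: "s I \<ge> 0" "g I \<ge> 0" for I by (auto simp: s_def g_def)
    have y0: "y I \<ge> 0" for I by (simp add: y_def)
    have yu: "y I powr u = s I * (g I / s I) powr P" for I
    proof -
      have "y I powr u = (s I * (g I / s I) powr P) powr (1 / u * u)"
        unfolding y_def by (rule powr_powr)
      also have "1 / u * u = 1" using u(1) by simp
      finally show ?thesis using sg[of I] by simp
    qed
    have y_sum: "(\<Sum>k<n. \<Sum>I\<in>L k. y I powr u) \<le> B * w" for n
      using emb(3)[of n] by (simp add: yu B_def mult.assoc)
    have term_eq: "epowr (box_average t f I) q * mass \<mu> (carleson_box I) = ennreal (lam I * y I)"
      if I: "I \<in> D" for I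
    proof -
      have "(g I / a I powr t) powr q * m I = lam I * y I"
      proof (cases "s I = 0")
        case True
        then show ?thesis using emb(2)[OF I] by (simp add: y_def)
      next
        case False
        then have s: "s I > 0" using sg(1)[of I] by simp
        have "y I = s I powr (1 / u) * (g I / s I) powr (P * (1 / u))"
          unfolding y_def using sg[of I] by (simp add: powr_mult powr_powr)
        also have "P * (1 / u) = q" using q by (simp add: u_def)
        finally have "s I powr e * y I = s I powr (e + 1 / u - q) * g I powr q"
          using s sg[of I] by (simp add: powr_divide powr_add powr_diff)
        also have "e + 1 / u - q = 0" using u(3) by (simp add: e_def right_diff_distrib)
        finally have "s I powr e * y I = g I powr q" using s by simp
        moreover have "(g I / a I powr t) powr q = a I powr (- t * q) * g I powr q"
          using sg[of I] by (simp add: powr_divide powr_powr powr_minus_divide)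
        moreover have "lam I = a I powr (- t * q) * m I * s I powr e"
          by (simp add: lam_def testing_coef_def a_def m_def s_def)
        ultimately show ?thesis by (simp add: mult_ac)
      qed
      moreover have "mass (\<lambda>z. ennreal (cmod (f z))) (carleson_box I) = ennreal (g I)"
        using emb(1)[OF I] by (simp add: g_def less_top)
      ultimately show ?thesis
        using box_sum_term[OF I, of q f "g I" \<mu> t] q fin_\<mu>[OF I] sg[of I] by (simp add: a_def m_def)
    qed
    have partial: "(\<Sum>k<n. \<Sum>I\<in>L k. lam I * y I) \<le> (\<Lambda> + B) * w powr (q / P)" for n
    proof (cases "w = 0")
      case True
      have "(\<Sum>k<n. \<Sum>I\<in>L k. y I powr u) = 0"
        using y_sum[of n] True by (intro antisym sum_nonneg) auto
      then have "y I = 0" if "k < n" "I \<in> L k" for k I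
        using that by (simp add: sum_nonneg_eq_0_iff sum_nonneg finite_layer)
      then show ?thesis using True by simp
    next
      case False
      then have w0: "w > 0" using w(2) by simp
      have "(\<Sum>k<n. \<Sum>I\<in>L k. lam I * y I)
          \<le> (\<Sum>k<n. \<Sum>I\<in>L k. w powr (q / P) * (lam I powr r + y I powr u / w))"
        using young_scaled[OF u(1) lam0 y0 w0] u by (intro sum_mono) simp
      also have "\<dots> = w powr (q / P) * ((\<Sum>k<n. \<Sum>I\<in>L k. lam I powr r) + (\<Sum>k<n. \<Sum>I\<in>L k. y I powr u) / w)"
        by (simp add: sum.distrib sum_distrib_left sum_divide_distrib distrib_left)
      also have "\<dots> \<le> w powr (q / P) * (\<Lambda> + B)"
        using lam_sum[of n] y_sum[of n] w0 by (intro mult_left_mono add_mono) (auto simp: field_simps)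
      finally show ?thesis by (simp add: mult_ac)
    qed
    have "box_sum q t \<mu> f \<le> ennreal ((\<Lambda> + B) * w powr (q / P))"
      unfolding box_sum_def
    proof (rule suminf_le_const)
      fix n
      have "(\<Sum>k<n. \<Sum>I\<in>L k. epowr (box_average t f I) q * mass \<mu> (carleson_box I))
          = (\<Sum>k<n. \<Sum>I\<in>L k. ennreal (lam I * y I))"
        using term_eq layer_in_D by (intro sum.cong) auto
      also have "\<dots> = ennreal (\<Sum>k<n. \<Sum>I\<in>L k. lam I * y I)"
        using lam0 y0 by (simp add: sum_nonneg)
      also have "\<dots> \<le> ennreal ((\<Lambda> + B) * w powr (q / P))"
        using partial by (rule ennreal_leI)
      finally show "(\<Sum>k<n. \<Sum>I\<in>L k. epowr (box_average t f I) q * mass \<mu> (carleson_box I)) \<le> \<dots>" .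
    qed simp
    then show ?thesis using q w(2) \<Lambda>(2) B0 by (simp add: epowr_ennreal ennreal_mult)
  qed
  then show ?thesis using \<Lambda>(2) B0
    by (intro exI[of _ "\<Lambda> + B"]) (auto simp: less_top_ennreal)
qed

text \<open>Testing on \<open>f = \<sigma> * \<Sum>\<^sub>I b\<^sub>I * 1\<^bsub>up I\<^esub>\<close>, the sum over the first \<open>n\<close> layers. The factor
  \<open>\<lambda>\<^sub>I powr (1 / (P - q))\<close> in \<open>b\<^sub>I\<close> is the extremal choice in the duality of sequence spaces, and
  \<open>\<sigma>\<^sub>I powr (- 1 / P)\<close> normalizes: both the integral of \<open>|f|\<^sup>P \<omega>\<close> over the upper half and the
  corresponding term of the sum become \<open>\<lambda>\<^sub>I powr r\<close>, up to constants. Cutting off after finitely many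
  layers makes the partial sum finite, so that it may be divided by.\<close>

lemma testing_coef_sum_finite:
  fixes q P K :: real and \<omega> :: "complex \<Rightarrow> ennreal"
  defines "\<sigma> \<equiv> (\<lambda>z. epowr (\<omega> z) (- 1 / (P - 1)))"
  assumes q: "1 \<le> q" "q < P" and \<omega>: "\<omega> \<in> borel_measurable dA"
    and \<mu>: "\<mu> \<in> B_inf D" and \<sigma>: "\<sigma> \<in> B_inf D"
    and K: "K \<ge> 0" "\<And>f. f \<in> borel_measurable dA \<Longrightarrow>
      (\<integral>\<^sup>+z. epowr (ennreal (cmod (f z))) P * \<omega> z \<partial>dA) < \<infinity> \<Longrightarrow>
      box_sum q t \<mu> f \<le> ennreal K * epowr (\<integral>\<^sup>+z. epowr (ennreal (cmod (f z))) P * \<omega> z \<partial>dA) (q / P)"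
  shows "(\<Sum>k. \<Sum>I\<in>L k. ennreal (testing_coef q t (q * (1 - 1 / P)) \<mu> \<sigma> I powr (P / (P - q)))) < \<infinity>"
proof -
  obtain C where C: "C > 1" "\<And>I. I \<in> D \<Longrightarrow> mass \<sigma> (carleson_box I) \<le> ennreal C * mass \<sigma> (carleson_up I)"
    and fin_\<sigma>: "\<And>I. I \<in> D \<Longrightarrow> mass \<sigma> (carleson_box I) < \<infinity>" and \<sigma>_m [measurable]: "\<sigma> \<in> borel_measurable dA"
    using B_infE[OF \<sigma>] by metis
  have fin_\<mu>: "\<And>I. I \<in> D \<Longrightarrow> mass \<mu> (carleson_box I) < \<infinity>"
    using B_infE[OF \<mu>] by metis
  have P: "P > 1" using q by simp
  note [measurable] = \<omega>
  define e where "e = q * (1 - 1 / P)"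
  define r where "r = P / (P - q)"
  define lam where "lam I = testing_coef q t e \<mu> \<sigma> I" for I
  have e0: "e > 0" using q by (simp add: e_def)
  have r0: "r > 0" using q by (simp add: r_def)
  have lam0: "lam I \<ge> 0" for I by (simp add: lam_def testing_coef_nonneg)
  define s where "s I = enn2real (mass \<sigma> (carleson_box I))" for I
  define m where "m I = enn2real (mass \<mu> (carleson_box I))" for I
  define a where "a I = measure dA (carleson_box I)" for I
  have s0: "s I \<ge> 0" for I by (simp add: s_def)
  have s_mass: "mass \<sigma> (carleson_box I) = ennreal (s I)" if "I \<in> D" for I
    using fin_\<sigma>[OF that] by (simp add: s_def less_top)
  have lam_eq: "lam I = a I powr (- t * q) * m I * s I powr e" for I
    by (simp add: lam_def testing_coef_def a_def m_def s_def)
  define b where "b I = lam I powr (1 / (P - q)) * s I powr (- 1 / P)" for I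
  have b0: "b I \<ge> 0" for I by (simp add: b_def)
  have norm_term: "b I powr P * s I \<le> lam I powr r" for I
  proof (cases "s I = 0")
    case False
    then have s: "s I > 0" using s0[of I] by simp
    have "b I powr P = lam I powr (1 / (P - q) * P) * s I powr (- 1 / P * P)"
      using lam0[of I] by (simp add: b_def powr_mult powr_powr)
    also have "1 / (P - q) * P = r" by (simp add: r_def)
    also have "- 1 / P * P = - 1" using P by simp
    finally show ?thesis using s by (simp add: powr_minus_divide)
  qed simp
  have box_term_lower: "C powr (- q) * lam I powr r \<le> (b I * s I / C / a I powr t) powr q * m I" for I
  proof (cases "s I = 0")
    case True
    then show ?thesis using e0 by (simp add: lam_eq)
  next
    case False
    then have s: "s I > 0" using s0[of I] by simp
    have C0: "C > 0" using C(1) by simp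
    have "(b I * s I / C / a I powr t) powr q * m I
        = b I powr q * s I powr q * C powr (- q) * a I powr (- t * q) * m I"
      using b0[of I] s C0 by (simp add: powr_divide powr_mult powr_powr powr_minus_divide)
    also have "b I powr q = lam I powr (1 / (P - q) * q) * s I powr (- 1 / P * q)"
      using lam0[of I] by (simp add: b_def powr_mult powr_powr)
    also have "lam I powr (1 / (P - q) * q) * s I powr (- 1 / P * q) * s I powr q * C powr (- q) * a I powr (- t * q) * m I
        = C powr (- q) * lam I powr (1 / (P - q) * q) * (a I powr (- t * q) * m I * s I powr (- 1 / P * q + q))"
      unfolding powr_add[of "s I" "- 1 / P * q" q] by (simp only: mult_ac)
    also have "- 1 / P * q + q = e" by (simp add: e_def right_diff_distrib)
    also have "C powr (- q) * lam I powr (1 / (P - q) * q) * (a I powr (- t * q) * m I * s I powr e)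
        = C powr (- q) * (lam I * lam I powr (1 / (P - q) * q))"
      unfolding lam_eq[symmetric] by (simp add: mult_ac)
    also have "lam I * lam I powr (1 / (P - q) * q) = lam I powr (1 + 1 / (P - q) * q)"
      using lam0[of I] by (rule powr_mult_base)
    also have "1 + 1 / (P - q) * q = r" using q by (simp add: r_def field_simps)
    finally show ?thesis by simp
  qed
  define c where "c = K * C powr q"
  have partial: "(\<Sum>k<n. \<Sum>I\<in>L k. lam I powr r) \<le> c powr r" for n
  proof -
    define S where "S = (\<Sum>k<n. \<Sum>I\<in>L k. lam I powr r)"
    define F where "F = (\<Union>k<n. L k)"
    have F: "finite F" "F \<subseteq> D" by (auto simp: F_def finite_layer D_def)
    have sum_F: "(\<Sum>I\<in>F. h I) = (\<Sum>k<n. \<Sum>I\<in>L k. h I)" for h :: "complex set \<Rightarrow> real"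
      unfolding F_def using layer_unique by (intro sum.UNION_disjoint) (auto simp: finite_layer)
    define d where "d z = (\<Sum>I\<in>F. b I * indicator (carleson_up I) z)" for z
    have d_up: "d z = b I" if "I \<in> F" "z \<in> carleson_up I" for I z
    proof -
      have "z \<notin> carleson_up J" if "J \<in> F" "J \<noteq> I" for J
        using up_unique[of I J z] that F \<open>I \<in> F\<close> \<open>z \<in> carleson_up I\<close> by blast
      then have "d z = (\<Sum>J\<in>F. if J = I then b I else 0)"
        unfolding d_def using that by (intro sum.cong) (auto simp: indicator_def)
      then show ?thesis using that F by simp
    qed
    have d0: "d z \<ge> 0" for z unfolding d_def using b0 by (intro sum_nonneg) auto
    define f where "f z = complex_of_real (enn2real (\<sigma> z) * d z)" for z
    have f_m [measurable]: "f \<in> borel_measurable dA"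
      unfolding f_def d_def by measurable (use F in auto)
    have cmod_f: "cmod (f z) = enn2real (\<sigma> z) * d z" for z
      using d0[of z] by (simp add: f_def norm_mult)
    have pointwise: "epowr (ennreal (cmod (f z))) P * \<omega> z
        \<le> (\<Sum>I\<in>F. ennreal (b I powr P) * (\<sigma> z * indicator (carleson_up I) z))" for z
    proof (cases "\<exists>I\<in>F. z \<in> carleson_up I")
      case False
      then have "d z = 0" unfolding d_def by (intro sum.neutral) (auto simp: indicator_def)
      then show ?thesis using P by (simp add: cmod_f epowr_def)
    next
      case True
      then obtain I where I: "I \<in> F" "z \<in> carleson_up I" by blast
      have "epowr (ennreal (cmod (f z))) P * \<omega> z \<le> ennreal (b I powr P) * \<sigma> z"
      proof (cases "\<omega> z = 0 \<or> \<omega> z = top")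
        case True
        then show ?thesis using P by (auto simp: cmod_f epowr_def \<sigma>_def)
      next
        case False
        then obtain v where v: "\<omega> z = ennreal v" "v > 0" by (cases "\<omega> z") auto
        define x where "x = v powr (- 1 / (P - 1))"
        have x: "x > 0" "\<sigma> z = ennreal x" using v P by (auto simp: x_def \<sigma>_def epowr_def)
        have "x powr P * v = v powr (- 1 / (P - 1) * P + 1)"
          unfolding x_def powr_powr powr_add using v by simp
        also have "- 1 / (P - 1) * P + 1 = - 1 / (P - 1)" using P by (simp add: field_simps)
        finally have "x powr P * v = x" by (simp add: x_def)
        moreover have "epowr (ennreal (cmod (f z))) P = ennreal (x powr P * b I powr P)"
          using P x b0[of I] d_up[OF I] by (simp add: cmod_f epowr_ennreal powr_mult)
        ultimately have "epowr (ennreal (cmod (f z))) P * \<omega> z = ennreal (b I powr P) * \<sigma> z"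
          using v x by (simp add: mult_ac flip: ennreal_mult)
        then show ?thesis by simp
      qed
      also have "\<dots> = ennreal (b I powr P) * (\<sigma> z * indicator (carleson_up I) z)" using I by simp
      also have "\<dots> \<le> (\<Sum>I\<in>F. ennreal (b I powr P) * (\<sigma> z * indicator (carleson_up I) z))"
        using I F by (intro member_le_sum) auto
      finally show ?thesis .
    qed
    define W where "W = (\<integral>\<^sup>+z. epowr (ennreal (cmod (f z))) P * \<omega> z \<partial>dA)"
    have up_le: "mass \<sigma> (carleson_up I) \<le> ennreal (s I)" if "I \<in> D" for I
      using mass_mono[OF up_subset_box[OF that], of \<sigma>] s_mass[OF that] by simp
    have "W \<le> (\<integral>\<^sup>+z. (\<Sum>I\<in>F. ennreal (b I powr P) * (\<sigma> z * indicator (carleson_up I) z)) \<partial>dA)"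
      unfolding W_def using pointwise by (intro nn_integral_mono)
    also have "\<dots> = (\<Sum>I\<in>F. ennreal (b I powr P) * mass \<sigma> (carleson_up I))"
    proof -
      have [measurable]: "carleson_up I \<in> sets dA" if "I \<in> F" for I
        using that F sets_box(2) by blast
      have "(\<integral>\<^sup>+z. (\<Sum>I\<in>F. ennreal (b I powr P) * (\<sigma> z * indicator (carleson_up I) z)) \<partial>dA)
          = (\<Sum>I\<in>F. \<integral>\<^sup>+z. ennreal (b I powr P) * (\<sigma> z * indicator (carleson_up I) z) \<partial>dA)"
        by (rule nn_integral_sum) measurable
      also have "\<dots> = (\<Sum>I\<in>F. ennreal (b I powr P) * mass \<sigma> (carleson_up I))"
        unfolding mass_def by (intro sum.cong refl nn_integral_cmult) measurable
      finally show ?thesis .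
    qed
    also have "\<dots> \<le> (\<Sum>I\<in>F. ennreal (b I powr P) * ennreal (s I))"
      using up_le F by (intro sum_mono mult_left_mono) auto
    also have "\<dots> = ennreal (\<Sum>I\<in>F. b I powr P * s I)"
      using s0 by (simp add: sum_nonneg flip: ennreal_mult)
    also have "\<dots> \<le> ennreal (\<Sum>I\<in>F. lam I powr r)"
      using norm_term by (intro ennreal_leI sum_mono)
    finally have W: "W \<le> ennreal S" by (simp add: sum_F S_def)
    have S0: "S \<ge> 0" unfolding S_def by (intro sum_nonneg) auto
    have lower: "ennreal (C powr (- q) * lam I powr r) \<le> epowr (box_average t f I) q * mass \<mu> (carleson_box I)"
      if IF: "I \<in> F" for I
    proof (cases "a I = 0")
      case True
      then show ?thesis by (simp add: lam_eq)
    next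
      case False
      then have a: "a I > 0" by (simp add: a_def less_le)
      have I: "I \<in> D" using IF F by auto
      \<comment> \<open>The test function replaces infinite values of \<open>\<sigma>\<close> by \<open>0\<close>; these occur only on a null set.\<close>
      have "(\<integral>\<^sup>+z. \<sigma> z * indicator (carleson_up I) z \<partial>dA) \<noteq> \<infinity>"
        using up_le[OF I] by (auto simp: mass_def top_unique)
      then have "AE z in dA. \<sigma> z * indicator (carleson_up I) z \<noteq> \<infinity>"
        using sets_box(2)[OF I] by (intro nn_integral_PInf_AE) auto
      then have "AE z in dA. ennreal (b I) * (\<sigma> z * indicator (carleson_up I) z)
          = ennreal (cmod (f z)) * indicator (carleson_up I) z"
      proof (rule AE_mp, intro AE_I2 impI)
        fix z assume z: "\<sigma> z * indicator (carleson_up I) z \<noteq> \<infinity>"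
        show "ennreal (b I) * (\<sigma> z * indicator (carleson_up I) z)
            = ennreal (cmod (f z)) * indicator (carleson_up I) z"
        proof (cases "z \<in> carleson_up I")
          case True
          then obtain x where "\<sigma> z = ennreal x" "x \<ge> 0" using z by (cases "\<sigma> z") auto
          then show ?thesis
            using True b0[of I] d_up[OF IF True] by (simp add: cmod_f mult.commute flip: ennreal_mult)
        qed simp
      qed
      then have eq: "ennreal (b I) * mass \<sigma> (carleson_up I) = mass (\<lambda>z. ennreal (cmod (f z))) (carleson_up I)"
        unfolding mass_def using sets_box(2)[OF I]
        by (subst nn_integral_cmult[symmetric]) (auto intro: nn_integral_cong_AE)
      obtain x where x: "mass \<sigma> (carleson_up I) = ennreal x" "x \<ge> 0"
        using up_le[OF I] by (cases "mass \<sigma> (carleson_up I)") (auto simp: top_unique)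
      have "s I \<le> C * x"
        using C(2)[OF I] C(1) x s_mass[OF I] by (simp flip: ennreal_mult)
      then have "b I * s I / C \<le> b I * x"
        using C(1) mult_left_mono[of "s I" "C * x" "b I"] b0[of I] by (simp add: field_simps)
      then have "ennreal (b I * s I / C) \<le> ennreal (b I) * ennreal x"
        using b0[of I] x by (simp add: ennreal_leI flip: ennreal_mult)
      also have "\<dots> \<le> mass (\<lambda>z. ennreal (cmod (f z))) (carleson_box I)"
        using eq x mass_mono[OF up_subset_box[OF I]] by metis
      finally have "ennreal (b I * s I / C) / ennreal (a I powr t) \<le> box_average t f I"
        unfolding box_average_def a_def by (rule divide_right_mono_ennreal)
      then have "epowr (ennreal (b I * s I / C / a I powr t)) q \<le> epowr (box_average t f I) q"
        using q a b0[of I] s0[of I] C(1) by (intro epowr_mono) (auto simp: divide_ennreal)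
      then have "ennreal ((b I * s I / C / a I powr t) powr q) * mass \<mu> (carleson_box I)
          \<le> epowr (box_average t f I) q * mass \<mu> (carleson_box I)"
        using q b0[of I] s0[of I] C(1) by (intro mult_right_mono) (auto simp: epowr_ennreal)
      moreover have "mass \<mu> (carleson_box I) = ennreal (m I)"
        using fin_\<mu>[OF I] by (simp add: m_def less_top)
      moreover have "m I \<ge> 0" by (simp add: m_def)
      ultimately have "ennreal ((b I * s I / C / a I powr t) powr q * m I)
          \<le> epowr (box_average t f I) q * mass \<mu> (carleson_box I)"
        by (simp only: ennreal_mult powr_ge_zero)
      then show ?thesis using ennreal_leI[OF box_term_lower[of I]] by (rule order_trans[rotated])
    qed
    have "ennreal (C powr (- q) * S) = (\<Sum>k<n. \<Sum>I\<in>L k. ennreal (C powr (- q) * lam I powr r))"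
      unfolding S_def by (simp add: sum_distrib_left sum_nonneg)
    also have "\<dots> \<le> (\<Sum>k<n. \<Sum>I\<in>L k. epowr (box_average t f I) q * mass \<mu> (carleson_box I))"
      using lower by (intro sum_mono) (auto simp: F_def)
    also have "\<dots> \<le> box_sum q t \<mu> f"
      unfolding box_sum_def by (intro sum_le_suminf) auto
    also have "\<dots> \<le> ennreal K * epowr W (q / P)"
    proof -
      have "W < \<infinity>" using W by (auto intro: le_less_trans)
      then show ?thesis using K(2)[OF f_m] unfolding W_def by blast
    qed
    also have "\<dots> \<le> ennreal K * epowr (ennreal S) (q / P)"
      using W q by (intro mult_left_mono epowr_mono) auto
    also have "\<dots> = ennreal (K * S powr (q / P))"
      using q S0 K(1) by (simp add: epowr_ennreal ennreal_mult)
    finally have "C powr (- q) * S \<le> K * S powr (q / P)"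
      using K(1) by (subst (asm) ennreal_le_iff) auto
    then have "C powr q * (C powr (- q) * S) \<le> C powr q * (K * S powr (q / P))"
      by (intro mult_left_mono) auto
    moreover have "C powr q * C powr (- q) = 1"
      using C(1) by (simp add: powr_minus)
    ultimately have main: "S \<le> c * S powr (q / P)"
      by (simp add: c_def mult_ac flip: mult.assoc)
    show ?thesis
    proof (cases "S = 0")
      case True
      then show ?thesis by (simp add: S_def)
    next
      case False
      then have S: "S > 0" using S0 by simp
      have "S powr (1 - q / P) \<le> c"
        using main S by (simp add: powr_diff field_simps)
      then have "(S powr (1 - q / P)) powr r \<le> c powr r"
        using r0 by (intro powr_mono2) auto
      also have "(S powr (1 - q / P)) powr r = S powr ((1 - q / P) * r)" by (rule powr_powr)
      also have "(1 - q / P) * r = 1" using q by (simp add: r_def field_simps)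
      finally show ?thesis using S by (simp add: S_def)
    qed
  qed
  have "(\<Sum>k. \<Sum>I\<in>L k. ennreal (lam I powr r)) \<le> ennreal (c powr r)"
  proof (rule suminf_le_const)
    show "(\<Sum>k<n. \<Sum>I\<in>L k. ennreal (lam I powr r)) \<le> ennreal (c powr r)" for n
      using ennreal_leI[OF partial[of n]] by (simp add: sum_nonneg)
  qed simp
  then show ?thesis by (auto simp: lam_def e_def r_def intro: le_less_trans)
qed

end

section \<open>The infinite exponent\<close>

context dyadic_layers
begin

lemma mass_one: "I \<in> D \<Longrightarrow> mass (\<lambda>_. 1) (carleson_box I) = ennreal (measure dA (carleson_box I))"
proof -
  assume I: "I \<in> D"
  interpret finite_measure dA by (rule finite_measure_dA)
  show ?thesis using sets_box(1)[OF I] by (simp add: mass_def emeasure_eq_measure)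
qed

lemma box_sum_one:
  assumes q: "q > 0" and \<mu>: "\<mu> \<in> B_inf D"
  shows "box_sum q t \<mu> (\<lambda>_. 1) = (\<Sum>k. \<Sum>I\<in>L k. ennreal (testing_coef q t q \<mu> (\<lambda>_. 1) I))"
  unfolding box_sum_def
proof (intro suminf_cong sum.cong refl)
  fix k I assume "I \<in> L k"
  then have I: "I \<in> D" by (rule layer_in_D)
  define a where "a = measure dA (carleson_box I)"
  have fin: "mass \<mu> (carleson_box I) < \<infinity>"
    using B_infE[OF \<mu>] I by metis
  have "(a / a powr t) powr q = a powr (- t * q) * a powr q"
    by (simp add: a_def powr_divide powr_powr powr_minus_divide)
  then have "(a / a powr t) powr q * enn2real (mass \<mu> (carleson_box I)) = testing_coef q t q \<mu> (\<lambda>_. 1) I"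
    using mass_one[OF I] by (simp add: testing_coef_def a_def)
  then show "epowr (box_average t (\<lambda>_. 1) I) q * mass \<mu> (carleson_box I)
      = ennreal (testing_coef q t q \<mu> (\<lambda>_. 1) I)"
    using box_sum_term[OF I q, of "\<lambda>_. 1" a \<mu> t] mass_one[OF I] fin by (simp add: a_def)
qed

text \<open>For bounded functions every average is at most the bound times the average of the constant \<open>1\<close>,
  so the constant is extremal.\<close>

lemma box_sum_le_esssup:
  assumes q: "q > 0" and n: "AE z in dA. ennreal (cmod (f z)) \<le> ennreal n" "n \<ge> 0"
  shows "box_sum q t \<mu> f \<le> ennreal (n powr q) * box_sum q t \<mu> (\<lambda>_. 1)"
proof -
  have average: "epowr (box_average t f I) q \<le> ennreal (n powr q) * epowr (box_average t (\<lambda>_. 1) I) q"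
    if I: "I \<in> D" for I
  proof -
    define a where "a = measure dA (carleson_box I)"
    have one: "box_average t (\<lambda>_. 1) I = ennreal (a / a powr t)"
      using box_average_eq[OF I, of "\<lambda>_. 1" a t] mass_one[OF I] by (simp add: a_def)
    have "mass (\<lambda>z. ennreal (cmod (f z))) (carleson_box I)
        \<le> (\<integral>\<^sup>+z. ennreal n * indicator (carleson_box I) z \<partial>dA)"
      unfolding mass_def using n(1) by (intro nn_integral_mono_AE) (auto simp: indicator_def elim: AE_mp)
    also have "\<dots> = ennreal n * mass (\<lambda>_. 1) (carleson_box I)"
      unfolding mass_def using sets_box(1)[OF I] by (subst nn_integral_cmult) auto
    finally have "box_average t f I \<le> ennreal n * mass (\<lambda>_. 1) (carleson_box I) / ennreal (a powr t)"
      unfolding box_average_def a_def by (rule divide_right_mono_ennreal)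
    also have "\<dots> = ennreal n * box_average t (\<lambda>_. 1) I"
      by (simp add: box_average_def a_def ennreal_times_divide)
    also have "\<dots> = ennreal (n * (a / a powr t))"
      unfolding one by (rule ennreal_mult[symmetric]) (use n(2) in \<open>auto simp: a_def\<close>)
    finally have "epowr (box_average t f I) q \<le> epowr (ennreal (n * (a / a powr t))) q"
      using q by (intro epowr_mono)
    also have "\<dots> = ennreal (n powr q) * epowr (box_average t (\<lambda>_. 1) I) q"
    proof -
      have "epowr (ennreal (n * x)) q = ennreal (n powr q) * epowr (ennreal x) q" if "x \<ge> 0" for x
        using that q n(2) by (simp add: epowr_ennreal powr_mult flip: ennreal_mult)
      from this[of "a / a powr t"] show ?thesis unfolding one by (simp add: a_def)
    qed
    finally show ?thesis .
  qed
  have "box_sum q t \<mu> f \<le> (\<Sum>k. ennreal (n powr q) *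
      (\<Sum>I\<in>L k. epowr (box_average t (\<lambda>_. 1) I) q * mass \<mu> (carleson_box I)))"
    unfolding box_sum_def sum_distrib_left mult.assoc[symmetric]
    using average layer_in_D by (intro suminf_le sum_mono mult_right_mono) auto
  then show ?thesis by (simp add: box_sum_def)
qed

end

section \<open>The equivalence\<close>

theorem theorem3p12:
  fixes p :: ereal and q t :: real
    and D :: "complex set set"
    and \<mu> \<omega> \<sigma> :: "complex \<Rightarrow> ennreal"
  assumes "1 \<le> q" and "ereal q < p" and "0 < t"
    and "dyadic_system D"
    and "weight \<mu>" and "weight \<omega>"
    and "\<sigma> = (\<lambda>z. epowr (\<omega> z) (sigma_exp p))"
    and "\<mu> \<in> B_inf D" and "\<sigma> \<in> B_inf D"
  shows "bounded_Lp_Lq p \<omega> (ereal q) \<mu> (maximal t D) \<longleftrightarrow>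
         phi p q t D \<mu> \<sigma> \<in> Lp (ereal (phi_exp p q)) (\<lambda>_. 1)"
proof -
  obtain L where "dyadic_layers L" and D: "D = dyadic_layers.D L"
    using dyadic_systemE[OF assms(4)] by blast
  then interpret dyadic_layers L by simp
  note \<mu> = assms(8)[unfolded D] and \<sigma> = assms(9)[unfolded D]
  have q: "q > 0" using assms(1) by simp
  have \<omega>: "\<omega> \<in> borel_measurable dA" using assms(6) by (simp add: weight_def)
  show ?thesis
  proof (cases p)
    case (real P)
    then have P: "q < P" "1 < P" using assms(1,2) by auto
    have exps: "sigma_exp p = - 1 / (P - 1)" "phi_exp p q = P / (P - q)" "q / conj_exp p = q * (1 - 1 / P)"
      using real P by (auto simp: sigma_exp_def phi_exp_def conj_exp_def field_simps)
    have \<sigma>_eq: "\<sigma> = (\<lambda>z. epowr (\<omega> z) (- 1 / (P - 1)))" using assms(7) exps by simp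
    define W where "W f = (\<integral>\<^sup>+z. epowr (ennreal (cmod (f z))) P * \<omega> z \<partial>dA)" for f :: "complex \<Rightarrow> complex"
    have norm: "Lp_norm p \<omega> (\<lambda>z. ennreal (cmod (f z))) = epowr (W f) (1 / P)" for f
      by (simp add: Lp_norm_def real W_def)
    have norm_fin: "epowr (W f) (1 / P) < \<infinity> \<longleftrightarrow> W f < \<infinity>" for f
      using epowr_less_top[of "1 / P" "W f"] P by simp
    have norm_q: "epowr (epowr (W f) (1 / P)) q = epowr (W f) (q / P)" for f
      using P q by (simp add: epowr_epowr)
    have "bounded_Lp_Lq p \<omega> (ereal q) \<mu> (maximal t D) \<longleftrightarrow>
        (\<exists>K\<ge>0. \<forall>f\<in>borel_measurable dA. W f < \<infinity> \<longrightarrow>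
           box_sum q t \<mu> f \<le> ennreal K * epowr (W f) (q / P))"
      unfolding D bounded_iff_box_sum[OF q \<mu>] norm norm_fin norm_q ..
    also have "\<dots> \<longleftrightarrow> (\<Sum>k. \<Sum>I\<in>L k. ennreal (testing_coef q t (q * (1 - 1 / P)) \<mu> \<sigma> I powr (P / (P - q)))) < \<infinity>"
    proof
      assume "\<exists>K\<ge>0. \<forall>f\<in>borel_measurable dA. W f < \<infinity> \<longrightarrow>
        box_sum q t \<mu> f \<le> ennreal K * epowr (W f) (q / P)"
      then show "(\<Sum>k. \<Sum>I\<in>L k. ennreal (testing_coef q t (q * (1 - 1 / P)) \<mu> \<sigma> I powr (P / (P - q)))) < \<infinity>"
        using testing_coef_sum_finite[OF assms(1) P(1) \<omega> \<mu>] \<sigma> unfolding W_def \<sigma>_eq by blast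
    next
      assume "(\<Sum>k. \<Sum>I\<in>L k. ennreal (testing_coef q t (q * (1 - 1 / P)) \<mu> \<sigma> I powr (P / (P - q)))) < \<infinity>"
      then obtain \<Lambda> where \<Lambda>: "\<Lambda> \<ge> 0"
        "(\<Sum>k. \<Sum>I\<in>L k. ennreal (testing_coef q t (q * (1 - 1 / P)) \<mu> \<sigma> I powr (P / (P - q)))) = ennreal \<Lambda>"
        using less_top_ennreal by auto
      then show "\<exists>K\<ge>0. \<forall>f\<in>borel_measurable dA. W f < \<infinity> \<longrightarrow>
          box_sum q t \<mu> f \<le> ennreal K * epowr (W f) (q / P)"
        using box_sum_le_of_finite_testing[OF assms(1) P(1) \<omega> \<mu>] \<sigma> unfolding W_def \<sigma>_eq by blast
    qed
    also have "\<dots> \<longleftrightarrow> phi p q t D \<mu> \<sigma> \<in> Lp (ereal (phi_exp p q)) (\<lambda>_. 1)"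
    proof -
      have "phi_exp p q > 0" "q / conj_exp p > 0" "1 / phi_exp p q = 1 - q + q / conj_exp p"
        using P q unfolding exps by (auto simp: field_simps)
      from phi_in_Lp_iff[OF this \<mu> \<sigma>, of t] show ?thesis unfolding D exps ..
    qed
    finally show ?thesis .
  next
    case PInf
    have exps: "sigma_exp p = 0" "phi_exp p q = 1" "conj_exp p = 1"
      using PInf by (auto simp: sigma_exp_def phi_exp_def conj_exp_def)
    have \<sigma>_eq: "\<sigma> = (\<lambda>_. 1)" using assms(7) exps by (simp add: epowr_def)
    have norm: "Lp_norm p \<omega> (\<lambda>z. ennreal (cmod (f z))) = esssup dA (\<lambda>z. ennreal (cmod (f z)))" for f
      by (simp add: Lp_norm_def PInf)
    have "bounded_Lp_Lq p \<omega> (ereal q) \<mu> (maximal t D) \<longleftrightarrow> box_sum q t \<mu> (\<lambda>_. 1) < \<infinity>"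
      unfolding D bounded_iff_box_sum[OF q \<mu>] norm
    proof
      assume "\<exists>K\<ge>0. \<forall>f\<in>borel_measurable dA. esssup dA (\<lambda>z. ennreal (cmod (f z))) < \<infinity> \<longrightarrow>
        box_sum q t \<mu> f \<le> ennreal K * epowr (esssup dA (\<lambda>z. ennreal (cmod (f z)))) q"
      moreover have "esssup dA (\<lambda>z. ennreal (cmod (1 :: complex))) \<le> 1"
        by (intro esssup_I) auto
      then have "esssup dA (\<lambda>z. ennreal (cmod (1 :: complex))) < \<infinity>"
        by (auto intro: le_less_trans)
      ultimately obtain K where "box_sum q t \<mu> (\<lambda>_. 1)
          \<le> ennreal K * epowr (esssup dA (\<lambda>z. ennreal (cmod (1 :: complex)))) q"
        by fastforce
      also have "\<dots> < \<infinity>"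
        using \<open>esssup dA (\<lambda>z. ennreal (cmod (1 :: complex))) < \<infinity>\<close> q
        by (auto simp: ennreal_mult_less_top epowr_less_top)
      finally show "box_sum q t \<mu> (\<lambda>_. 1) < \<infinity>" .
    next
      assume "box_sum q t \<mu> (\<lambda>_. 1) < \<infinity>"
      then obtain K where K: "box_sum q t \<mu> (\<lambda>_. 1) = ennreal K" "K \<ge> 0"
        by (cases "box_sum q t \<mu> (\<lambda>_. 1)") auto
      show "\<exists>K\<ge>0. \<forall>f\<in>borel_measurable dA. esssup dA (\<lambda>z. ennreal (cmod (f z))) < \<infinity> \<longrightarrow>
        box_sum q t \<mu> f \<le> ennreal K * epowr (esssup dA (\<lambda>z. ennreal (cmod (f z)))) q"
      proof (intro exI[of _ K] conjI ballI impI K(2))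
        fix f :: "complex \<Rightarrow> complex"
        assume "esssup dA (\<lambda>z. ennreal (cmod (f z))) < \<infinity>"
        then obtain n where n: "esssup dA (\<lambda>z. ennreal (cmod (f z))) = ennreal n" "n \<ge> 0"
          by (cases "esssup dA (\<lambda>z. ennreal (cmod (f z)))") auto
        have "AE z in dA. ennreal (cmod (f z)) \<le> ennreal n"
          using esssup_AE[of "\<lambda>z. ennreal (cmod (f z))" dA] by (simp add: n)
        then show "box_sum q t \<mu> f \<le> ennreal K * epowr (esssup dA (\<lambda>z. ennreal (cmod (f z)))) q"
          using box_sum_le_esssup[OF q _ n(2), of f t \<mu>] q n(2)
          by (simp add: n(1) K(1) epowr_ennreal mult.commute)
      qed
    qed
    also have "\<dots> \<longleftrightarrow> phi p q t D \<mu> \<sigma> \<in> Lp (ereal (phi_exp p q)) (\<lambda>_. 1)"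
    proof -
      have "phi_exp p q > 0" "q / conj_exp p > 0" "1 / phi_exp p q = 1 - q + q / conj_exp p"
        using q unfolding exps by auto
      from phi_in_Lp_iff[OF this \<mu> \<sigma>, of t] show ?thesis
        using testing_coef_nonneg unfolding D exps \<sigma>_eq box_sum_one[OF q \<mu>] by simp
    qed
    finally show ?thesis .
  next
    case MInf
    then show ?thesis using assms(2) by simp
  qed
qed

end
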